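(* Consider the separable variable-coefficient problem with operator $\mathcal L[u]=-a(x)\partial_{xx}u-b(y)\partial_{yy}u+c(x)d(y)u$ on $\Omega=(-1,1)^2$ (homogeneous Dirichlet boundary conditions), its Lagrange and Birkhoff collocation matrices $\mathbf A_{\rm L},\mathbf A_{\rm B}$, and the corresponding right preconditioners $\mathbf P_{\rm L},\mathbf P_{\rm B}$. If $$a,b,c,d\in C[-1,1],\quad a(x),b(y)>0,\quad c(x)d(y)\ge 0,$$ then all eigenvalues $\lambda\in\lambda(\mathbf A_{\rm L}\mathbf P_{\rm L})=\lambda(\mathbf A_{\rm B}\mathbf P_{\rm B})$ are real and $\lambda\ge 1$. If in addition $$0<\alpha\le a(x),\,b(y)\le\beta,\qquad 0\le q_{\min}\le c(x)d(y)\le q_{\max},$$ then $$1+\frac{2\pi^2 q_{\min}}{\beta c_N N^4}\le\lambda<1+\frac{2q_{\max}}{\alpha\pi^2},$$ where $c_N$ is the constant appearing in the eigenvalue bound for $\mathbf D^{(2)}$, $-c_N\frac{N^4}{4\pi^2}=\lambda_1<\cdots<\lambda_{N-1}<-\frac{\pi^2}{4}<0$.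
   Context: $\mathbb P_N$ is the space of polynomials of degree at most $N$. Let $-1=x_0<x_1<\cdots<x_N=1$ be the Legendre-Gauss-Lobatto (LGL) nodes, i.e. the zeros of $(1-x^2)L_N'(x)$ with $L_N$ the Legendre polynomial of degree $N$; the same nodes $y_j=x_j$ are used in the $y$ direction. Let $\ell_j\in\mathbb P_N$ be the Lagrange basis polynomials, $\ell_j(x_i)=\delta_{ij}$, and let $\mathbf D^{(2)}=(\ell_j''(x_i))_{1\le i,j\le N-1}$ be the interior second-order differentiation matrix. It is recalled as a known fact that $\mathbf D^{(2)}$ is nonsingular and its $N-1$ eigenvalues $\lambda_1,\dots,\lambda_{N-1}$ are negative and distinct, with $-c_N\frac{N^4}{4\pi^2}=\lambda_1<\cdots<\lambda_{N-1}<-\frac{\pi^2}{4}<0$, where $c_N\approx1$ for sufficiently large $N$. For $1\le j\le N-1$, $B_j\in\mathbb P_N$ is the polynomial with $B_j(\pm1)=0$ and $B_j''(x_i)=\delta_{ij}$ for $1\le i\le N-1$, and $\mathbf B=(B_j(x_i))_{1\le i,j\le N-1}=(\mathbf D^{(2)})^{-1}$. Put $\mathbf C_a=\operatorname{diag}(a(x_i))_{i=1}^{N-1}$, $\mathbf C_b=\operatorname{diag}(b(y_j))_{j=1}^{N-1}$, $\mathbf C_c=\operatorname{diag}(c(x_i))_{i=1}^{N-1}$, $\mathbf C_d=\operatorname{diag}(d(y_j))_{j=1}^{N-1}$. With $\otimes$ the Kronecker product and $\mathbf I_{N-1}$ the identity matrix of order $N-1$, $$\mathbf K_{\rm L}=-\mathbf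 I_{N-1}\otimes(\mathbf C_a\mathbf D^{(2)})-(\mathbf C_b\mathbf D^{(2)})\otimes\mathbf I_{N-1},\quad \mathbf A_{\rm L}=\mathbf K_{\rm L}+\mathbf C_d\otimes\mathbf C_c,\quad \mathbf P_{\rm L}=\mathbf K_{\rm L}^{-1},$$ $$\mathbf K_{\rm B}=-\mathbf B\otimes\mathbf C_a-\mathbf C_b\otimes\mathbf B,\quad \mathbf A_{\rm B}=\mathbf K_{\rm B}+(\mathbf C_d\mathbf B)\otimes(\mathbf C_c\mathbf B),\quad \mathbf P_{\rm B}=\mathbf K_{\rm B}^{-1}.$$ For a square matrix $\mathbf A$, $\lambda(\mathbf A)$ denotes its spectrum.
   Formalization: The upper bound is proved for those N where all eigenvalues of D^(2) are indeed < -π²/4 (this fails e.g. for N=2, where a=b=c=d=1 violates the bound), and it is strict only if q_max>0 (for q_max=0, λ=1 equals the bound). *)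

theory Defs
  imports
    Complex_Main
    "HOL-Computational_Algebra.Polynomial"
    "Jordan_Normal_Form.Gauss_Jordan_Elimination"
    "Jordan_Normal_Form.Spectral_Radius"
begin

text \<open>Legendre polynomials by Rodrigues' formula:
  $L_n = \frac{1}{2^n n!} \frac{d^n}{dx^n} (x^2-1)^n$.\<close>

definition legendre :: "nat \<Rightarrow> real poly" where
  "legendre n = Polynomial.smult (1 / (2 ^ n * fact n)) ((pderiv ^^ n) ([:-1, 0, 1:] ^ n))"

text \<open>\<open>lgl N j\<close> is $x_j$ for $0 \le j \le N$; the zeros of $(1-x^2) L_N'$ are listed increasingly.\<close>

definition lgl :: "nat \<Rightarrow> nat \<Rightarrow> real" where
  "lgl N j = sorted_list_of_set {x. poly ([:1, 0, -1:] * pderiv (legendre N)) x = 0} ! j"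

definition lagrange :: "nat \<Rightarrow> nat \<Rightarrow> real poly" where
  "lagrange N j = (THE p. degree p \<le> N \<and> (\<forall>i\<le>N. poly p (lgl N i) = of_bool (i = j)))"

definition birkhoff :: "nat \<Rightarrow> nat \<Rightarrow> real poly" where
  "birkhoff N j = (THE p. degree p \<le> N \<and> poly p (-1) = 0 \<and> poly p 1 = 0 \<and>
     (\<forall>i\<in>{1..N-1}. poly (pderiv (pderiv p)) (lgl N i) = of_bool (i = j)))"

text \<open>Matrix rows and columns are numbered from 0, so position \<open>i\<close> of an
  \<open>(N-1) \<times> (N-1)\<close> matrix belongs to the interior node \<open>lgl N (Suc i)\<close>.\<close>

definition D2 :: "nat \<Rightarrow> real mat" where
  "D2 N = mat (N - 1) (N - 1)
     (\<lambda>(i, j). poly (pderiv (pderiv (lagrange N (Suc j)))) (lgl N (Suc i)))"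

definition Bmat :: "nat \<Rightarrow> real mat" where
  "Bmat N = mat (N - 1) (N - 1) (\<lambda>(i, j). poly (birkhoff N (Suc j)) (lgl N (Suc i)))"

definition Cmat :: "nat \<Rightarrow> (real \<Rightarrow> real) \<Rightarrow> real mat" where
  "Cmat N f = mat_diag (N - 1) (\<lambda>i. f (lgl N (Suc i)))"

definition kronecker :: "'a :: times mat \<Rightarrow> 'a mat \<Rightarrow> 'a mat" where
  "kronecker A B = mat (dim_row A * dim_row B) (dim_col A * dim_col B)
     (\<lambda>(i, j). A $$ (i div dim_row B, j div dim_col B) * B $$ (i mod dim_row B, j mod dim_col B))"

text \<open>The spectrum of a real matrix is taken over the complex numbers.\<close>

definition complex_spectrum :: "real mat \<Rightarrow> complex set" where
  "complex_spectrum A = spectrum (map_mat complex_of_real A)"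

text \<open>The constant $c_N$ is determined by $-c_N \frac{N^4}{4\pi^2} = \lambda_1$, the smallest eigenvalue of
  $\mathbf D^{(2)}$. (All these eigenvalues are real, so \<open>Re\<close> only changes the type.)\<close>

definition c_const :: "nat \<Rightarrow> real" where
  "c_const N = - Min (Re ` complex_spectrum (D2 N)) * (4 * pi\<^sup>2) / real N ^ 4"

definition K_L :: "nat \<Rightarrow> (real \<Rightarrow> real) \<Rightarrow> (real \<Rightarrow> real) \<Rightarrow> real mat" where
  "K_L N a b = - kronecker (1\<^sub>m (N - 1)) (Cmat N a * D2 N) - kronecker (Cmat N b * D2 N) (1\<^sub>m (N - 1))"

definition A_L ::
  "nat \<Rightarrow> (real \<Rightarrow> real) \<Rightarrow> (real \<Rightarrow> real) \<Rightarrow> (real \<Rightarrow> real) \<Rightarrow> (real \<Rightarrow> real) \<Rightarrow> real mat" where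
  "A_L N a b c d = K_L N a b + kronecker (Cmat N d) (Cmat N c)"

definition P_L :: "nat \<Rightarrow> (real \<Rightarrow> real) \<Rightarrow> (real \<Rightarrow> real) \<Rightarrow> real mat" where
  "P_L N a b = the (mat_inverse (K_L N a b))"

definition K_B :: "nat \<Rightarrow> (real \<Rightarrow> real) \<Rightarrow> (real \<Rightarrow> real) \<Rightarrow> real mat" where
  "K_B N a b = - kronecker (Bmat N) (Cmat N a) - kronecker (Cmat N b) (Bmat N)"

definition A_B ::
  "nat \<Rightarrow> (real \<Rightarrow> real) \<Rightarrow> (real \<Rightarrow> real) \<Rightarrow> (real \<Rightarrow> real) \<Rightarrow> (real \<Rightarrow> real) \<Rightarrow> real mat" where
  "A_B N a b c d = K_B N a b + kronecker (Cmat N d * Bmat N) (Cmat N c * Bmat N)"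

definition P_B :: "nat \<Rightarrow> (real \<Rightarrow> real) \<Rightarrow> (real \<Rightarrow> real) \<Rightarrow> real mat" where
  "P_B N a b = the (mat_inverse (K_B N a b))"

end

theory Submission
  imports Defs
begin

text \<open>
  The quadrature rule on the LGL nodes is exact up to degree $2N-1$, so its interior weights $W$ satisfy
  $u^T W \mathbf D^{(2)} v = \int p_u'' p_v = -\int p_u' p_v'$ for the interpolants of $u$ and $v$;
  hence $W \mathbf D^{(2)}$ is symmetric and negative definite.
  If $\lambda$ is an eigenvalue of $\mathbf A_{\rm L} \mathbf P_{\rm L}$, there is $u \neq 0$ with
  $(\lambda - 1) \mathbf K_{\rm L} u = (\mathbf C_d \otimes \mathbf C_c) u$. Multiplying by $u^* M$ with the diagonal
  matrix $M = \mathbf C_b^{-1} W \otimes \mathbf C_a^{-1} W$ turns the left side into a positive definite Hermitian form,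
  so $\lambda - 1$ is a quotient of two real forms, and the Rayleigh bounds for $\mathbf D^{(2)}$ compare the
  denominator with $u^* M u$. The Birkhoff matrices arise from the Lagrange ones by multiplication with
  $\mathbf B \otimes \mathbf B$ from the right, which cancels in $\mathbf A_{\rm B} \mathbf P_{\rm B}$.
\<close>

section \<open>Integration of polynomials and Rodrigues' formula\<close>

text \<open>The obstacle: \<open>K_L\<close> is in general not symmetric and its eigenvectors are a
  priori complex, while the facts about \<open>D2\<close> concern a real form in one variable.
  Separability resolves this. On a grid line, M cancels the coefficient belonging to the
  differentiated variable, and the rest of M is W times a factor constant along the line. So the
  two-dimensional form is a positive combination of one-dimensional energies, each splitting into a
  real and an imaginary part. Every such energy lies between -\<lambda>_{N-1} and -\<lambda>_1 times
  the norm weighted by W. Returning from W to M costs one value of \<open>a\<close> or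
  \<open>b\<close>, that is, a factor \<alpha> or \<beta>. Two directions contribute, hence the
  denominators 2 m \<beta> with m = -\<lambda>_1 = c_N N^4 / (4 pi^2), and 2 m \<alpha> with m =
  -\<lambda>_{N-1} > pi^2 / 4. These are the constants of the theorem.\<close>

definition poly_integral :: "real poly \<Rightarrow> real" where
  "poly_integral p = (let q = (SOME q. pderiv q = p) in poly q 1 - poly q (-1))"

lemma antiderivative_exists: "\<exists>q. pderiv q = (p :: real poly)"
proof
  let ?q = "\<Sum>i\<le>Polynomial.degree p. Polynomial.monom (Polynomial.coeff p i / real (Suc i)) (Suc i)"
  show "pderiv ?q = p"
    by (simp add: pderiv_sum pderiv_monom poly_as_sum_of_monoms del: of_nat_Suc)
qed

text \<open>Two antiderivatives differ by a constant, which cancels in the difference of endpoint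
  values; so the choice made by \<open>SOME\<close> does not matter.\<close>

lemma poly_integral_eq:
  assumes "pderiv q = p"
  shows "poly_integral p = poly q 1 - poly q (-1)"
proof -
  define r where "r = (SOME q. pderiv q = p)"
  have "pderiv r = p"
    unfolding r_def using someI[of "\<lambda>q. pderiv q = p", OF assms] .
  then have "pderiv (r - q) = 0"
    using assms by (simp add: pderiv_diff)
  then obtain k where "r - q = [:k:]"
    by (metis pderiv_eq_0_iff degree_eq_zeroE)
  then have "poly (r - q) 1 = poly (r - q) (-1)"
    by simp
  then show ?thesis
    by (simp add: poly_integral_def r_def[symmetric] Let_def)
qed

lemma poly_integral_0 [simp]: "poly_integral 0 = 0"
  using poly_integral_eq[of 0 0] by simp

lemma poly_integral_add: "poly_integral (p + q) = poly_integral p + poly_integral q"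
proof -
  obtain f g where "pderiv f = p" "pderiv g = q"
    using antiderivative_exists by metis
  then show ?thesis
    using poly_integral_eq[of f p] poly_integral_eq[of g q] poly_integral_eq[of "f + g" "p + q"]
    by (simp add: pderiv_add)
qed

lemma poly_integral_smult: "poly_integral (Polynomial.smult k p) = k * poly_integral p"
proof -
  obtain f where "pderiv f = p"
    using antiderivative_exists by metis
  then show ?thesis
    using poly_integral_eq[of f p] poly_integral_eq[of "Polynomial.smult k f" "Polynomial.smult k p"]
    by (simp add: pderiv_smult right_diff_distrib)
qed

lemma poly_integral_sum: "poly_integral (sum f A) = (\<Sum>x\<in>A. poly_integral (f x))"
  by (induction A rule: infinite_finite_induct) (simp_all add: poly_integral_add)

lemma poly_integral_by_parts:
  assumes "poly (p * q) 1 = 0" "poly (p * q) (-1) = 0"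
  shows "poly_integral (pderiv p * q) = - poly_integral (p * pderiv q)"
proof -
  have "poly_integral (pderiv (p * q)) = 0"
    using poly_integral_eq[OF refl, of "p * q"] assms by (simp del: poly_mult)
  then show ?thesis
    by (simp add: pderiv_mult poly_integral_add algebra_simps)
qed

text \<open>An antiderivative is nondecreasing on [-1,1]. If its endpoint values agreed, it would be
  constant on infinitely many points, hence a constant polynomial, and \<open>p\<close> would be
  0.\<close>

lemma poly_integral_pos:
  assumes nonneg: "\<And>x. x \<in> {-1..1} \<Longrightarrow> 0 \<le> poly p x" and "p \<noteq> 0"
  shows "0 < poly_integral p"
proof -
  obtain q where q: "pderiv q = p"
    using antiderivative_exists by metis
  have mono: "poly q x \<le> poly q y" if "-1 \<le> x" "x \<le> y" "y \<le> 1" for x y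
  proof (rule DERIV_nonneg_imp_nondecreasing[OF that(2)])
    fix t assume "x \<le> t" "t \<le> y"
    then show "\<exists>z. DERIV (poly q) t :> z \<and> 0 \<le> z"
      using that nonneg q poly_DERIV[of q t] by (intro exI[of _ "poly p t"]) auto
  qed
  have "poly q (-1) \<noteq> poly q 1"
  proof
    assume "poly q (-1) = poly q 1"
    then have "poly (q - [:poly q 1:]) x = 0" if "x \<in> {-1..1}" for x
      using mono[of "-1" x] mono[of x 1] that by auto
    then have "{-1..1} \<subseteq> {x. poly (q - [:poly q 1:]) x = 0}"
      by blast
    then have "infinite {x. poly (q - [:poly q 1:]) x = 0}"
      by (rule infinite_super) (simp add: infinite_Icc)
    then have "q - [:poly q 1:] = 0"
      by (metis poly_roots_finite)
    then have "q = [:poly q 1:]"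
      by (simp only: right_minus_eq)
    then have "pderiv q = 0"
      by (metis pderiv_pCons pderiv_0 pCons_0_0 add_0)
    then show False
      using q \<open>p \<noteq> 0\<close> by simp
  qed
  then show ?thesis
    using mono[of "-1" 1] poly_integral_eq[OF q] by simp
qed

section \<open>Roots and orthogonality of Legendre polynomials\<close>

text \<open>Rolle's theorem with counting. Induction adds the largest root \<open>b\<close>: the
  critical point between the old maximum and \<open>b\<close> lies above all earlier ones, so it is
  new. The location strictly between \<open>Min S\<close> and \<open>Max S\<close> is what lets
  endpoints be added again as fresh roots.\<close>

lemma pderiv_roots:
  fixes p :: "real poly"
  assumes "finite S" "\<And>x. x \<in> S \<Longrightarrow> poly p x = 0" "S \<noteq> {}"
  shows "\<exists>T. finite T \<and> Suc (card T) = card S \<and> T \<subseteq> {Min S<..<Max S} \<and> (\<forall>x\<in>T. poly (pderiv p) x = 0)"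
  using assms
proof (induction S rule: finite_linorder_max_induct)
  case empty
  then show ?case by simp
next
  case (insert b A)
  show ?case
  proof (cases "A = {}")
    case True
    then show ?thesis by (intro exI[of _ "{}"]) auto
  next
    case False
    then obtain T where T: "finite T" "Suc (card T) = card A" "T \<subseteq> {Min A<..<Max A}"
      "\<forall>x\<in>T. poly (pderiv p) x = 0"
      using insert by auto
    have mA: "Max A \<in> A" "Min A \<in> A" and ltb: "Max A < b" "Min A < b"
      using False insert by auto
    obtain t where t: "Max A < t" "t < b" "poly (pderiv p) t = 0"
      using poly_MVT[OF ltb(1), of p] insert.prems(1)[of b] insert.prems(1)[of "Max A"] mA ltb by auto
    have "Min (insert b A) = Min A" "Max (insert b A) = b"
      using ltb unfolding Min_insert[OF insert.hyps(1) False] Max_insert[OF insert.hyps(1) False]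
      by linarith+
    moreover have "t \<notin> T" "Min A < t"
      using T(3) t ltb mA Min_le[OF insert.hyps(1) mA(1)] by auto
    moreover have "b \<notin> A"
      using insert.hyps by auto
    ultimately show ?thesis
      using T t ltb insert.hyps(1) by (intro exI[of _ "insert t T"]) force
  qed
qed

text \<open>The stages of Rodrigues' formula for fixed \<open>N\<close>; at \<open>k = N\<close>
  this is \<open>legendre N\<close> up to a scalar. Root counting and orthogonality are proved by
  induction over these stages.\<close>

abbreviation rodrigues :: "nat \<Rightarrow> nat \<Rightarrow> real poly" where
  "rodrigues N k \<equiv> (pderiv ^^ k) ([:-1, 0, 1:] ^ N)"

text \<open>By the product rule, each differentiation costs at most one factor
  \<open>f\<close>.\<close>

lemma power_dvd_higher_pderiv:
  fixes f p :: "real poly"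
  assumes "f ^ (m + k) dvd p"
  shows "f ^ m dvd (pderiv ^^ k) p"
  using assms
proof (induction k arbitrary: p)
  case (Suc k)
  then obtain s where s: "p = f ^ Suc (m + k) * s" by (metis add_Suc_right dvdE)
  have "pderiv p = f ^ (m + k) * (f * pderiv s + Polynomial.smult (of_nat (Suc (m + k))) (pderiv f) * s)"
    unfolding s pderiv_mult pderiv_power_Suc by (simp add: algebra_simps)
  then have "f ^ m dvd (pderiv ^^ k) (pderiv p)"
    by (intro Suc.IH) simp
  then show ?case
    by (simp add: funpow_swap1)
qed simp

lemma rodrigues_endpoints:
  assumes "k < N"
  shows "poly (rodrigues N k) 1 = 0" "poly (rodrigues N k) (-1) = 0"
proof -
  have "[:-1, 0, 1:] ^ 1 dvd rodrigues N k"
    using assms by (intro power_dvd_higher_pderiv le_imp_power_dvd) auto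
  then show "poly (rodrigues N k) 1 = 0" "poly (rodrigues N k) (-1) = 0"
    by (auto simp: dvd_def)
qed

text \<open>Before stage \<open>N\<close> the endpoints are still roots. Together with the
  \<open>k\<close> interior roots they make \<open>k + 2\<close>, and Rolle yields
  \<open>k + 1\<close> roots that are again interior.\<close>

lemma rodrigues_roots:
  assumes "k \<le> N"
  shows "\<exists>T. finite T \<and> card T = k \<and> T \<subseteq> {-1<..<1} \<and> (\<forall>x\<in>T. poly (rodrigues N k) x = 0)"
  using assms
proof (induction k)
  case (Suc k)
  then obtain T where T: "finite T" "card T = k" "T \<subseteq> {-1<..<1}" "\<forall>x\<in>T. poly (rodrigues N k) x = 0"
    by auto
  let ?S = "insert (-1) (insert 1 T)"
  have "-1 \<notin> T" "1 \<notin> T"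
    using T(3) by auto
  then have "card ?S = Suc (Suc k)"
    using T by (auto simp: card_insert_if)
  moreover have "Min ?S = -1" "Max ?S = 1"
    using T(1,3) by (fastforce intro!: Min_eqI Max_eqI simp del: Min_insert Max_insert)+
  moreover have "poly (rodrigues N k) x = 0" if "x \<in> ?S" for x
    using that T rodrigues_endpoints[of k N] Suc.prems by auto
  ultimately show ?case
    using pderiv_roots[of ?S "rodrigues N k"] T(1) by auto
qed (auto intro!: exI[of _ "{}"])

text \<open>Each integration by parts undoes one derivative on the left and lowers the degree of
  \<open>r\<close>; the boundary terms vanish because the stage reached is below \<open>N\<close>.
  Constant \<open>r\<close> is a case of its own: its derivative is 0, but degree 0 is not below
  \<open>k\<close> when \<open>k = 0\<close>.\<close>

lemma rodrigues_orthogonal: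
  assumes "k \<le> N" "Polynomial.degree r < k"
  shows "poly_integral (rodrigues N k * r) = 0"
  using assms
proof (induction k arbitrary: r)
  case (Suc k)
  have "poly_integral (rodrigues N k * pderiv r) = 0"
  proof (cases "Polynomial.degree r = 0")
    case True
    then have "pderiv r = 0" by (simp add: pderiv_eq_0_iff)
    then show ?thesis by simp
  next
    case False
    then show ?thesis
      using Suc by (intro Suc.IH) (auto simp: degree_pderiv)
  qed
  then show ?case
    using poly_integral_by_parts[of "rodrigues N k" r] rodrigues_endpoints[of k N] Suc.prems by simp
qed simp

lemma degree_legendre: "Polynomial.degree (legendre N) = N"
  by (simp add: legendre_def degree_higher_pderiv degree_power_eq)

lemma legendre_orthogonal:
  assumes "Polynomial.degree r < N"
  shows "poly_integral (legendre N * r) = 0"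
  using rodrigues_orthogonal[of N N r] assms by (simp add: legendre_def poly_integral_smult)

text \<open>The factor 1 - x^2 removes the boundary terms, so the derivative moves from
  \<open>legendre N\<close> to (1 - x^2) q, whose derivative has degree below \<open>N\<close>. This
  orthogonality makes the interior nodes the Gauss nodes for the weight 1 - x^2.\<close>

lemma pderiv_legendre_orthogonal:
  assumes "Suc (Polynomial.degree q) < N"
  shows "poly_integral ([:1, 0, -1:] * (pderiv (legendre N) * q)) = 0"
proof -
  let ?w = "[:1, 0, -1:] * q"
  have "Polynomial.degree ?w \<le> Polynomial.degree q + 2"
    by (rule order.trans[OF degree_mult_le]) simp
  then have "Polynomial.degree (pderiv ?w) < N"
    unfolding degree_pderiv using assms by linarith
  then have "poly_integral (legendre N * pderiv ?w) = 0"
    by (rule legendre_orthogonal)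
  then have "poly_integral (pderiv (legendre N) * ?w) = 0"
    by (subst poly_integral_by_parts) simp_all
  then show ?thesis
    by (simp only: mult.left_commute)
qed

lemma degree_pderiv_legendre: "Polynomial.degree (pderiv (legendre N)) = N - 1"
  by (simp add: degree_pderiv degree_legendre)

text \<open>Rolle applied to the \<open>N\<close> roots of \<open>legendre N\<close> gives
  \<open>N - 1\<close> roots in the open interval, and the degree leaves room for no others.\<close>

lemma pderiv_legendre_roots:
  assumes "N \<ge> 2"
  shows "{x. poly (pderiv (legendre N)) x = 0} \<subseteq> {-1<..<1}"
    and "card {x. poly (pderiv (legendre N)) x = 0} = N - 1"
    and "finite {x. poly (pderiv (legendre N)) x = 0}"
proof -
  let ?Z = "{x. poly (pderiv (legendre N)) x = 0}"
  have nz: "pderiv (legendre N) \<noteq> 0"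
    using assms by (simp add: pderiv_eq_0_iff degree_legendre)
  then show fin: "finite ?Z"
    by (rule poly_roots_finite)
  obtain S where S: "finite S" "card S = N" "S \<subseteq> {-1<..<1}" "\<forall>x\<in>S. poly (rodrigues N N) x = 0"
    using rodrigues_roots[of N N] by auto
  have "S \<noteq> {}"
    using S(2) assms by auto
  moreover have "poly (legendre N) x = 0" if "x \<in> S" for x
    using that S by (simp add: legendre_def)
  ultimately obtain T where T: "finite T" "Suc (card T) = card S" "T \<subseteq> {Min S<..<Max S}"
      "\<forall>x\<in>T. poly (pderiv (legendre N)) x = 0"
    using pderiv_roots[of S "legendre N"] S(1) by auto
  have "Min S \<in> S" "Max S \<in> S"
    using \<open>S \<noteq> {}\<close> S(1) by auto
  then have T1: "T \<subseteq> {-1<..<1}"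
    using T(3) S(3) by fastforce
  have "T \<subseteq> ?Z"
    using T by auto
  moreover have "card ?Z \<le> card T"
    using card_poly_roots_bound[OF nz] T S by (simp add: degree_pderiv_legendre)
  ultimately have "T = ?Z"
    using fin card_seteq by blast
  then show "?Z \<subseteq> {-1<..<1}" "card ?Z = N - 1"
    using T1 T(2) S(2) by auto
qed

section \<open>The Legendre-Gauss-Lobatto nodes\<close>

lemma sorted_list_of_set_add_bounds:
  assumes "finite Z" "Z \<subseteq> {a<..<b}" "a < b"
  shows "sorted_list_of_set (insert a (insert b Z)) = a # sorted_list_of_set Z @ [b]"
proof (rule sorted_distinct_set_unique)
  show "sorted (a # sorted_list_of_set Z @ [b])" "distinct (a # sorted_list_of_set Z @ [b])"
    using assms by (force simp: sorted_append)+
  have "finite (insert a (insert b Z))"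
    using assms by simp
  from set_sorted_list_of_set[OF this]
  show "set (sorted_list_of_set (insert a (insert b Z))) = set (a # sorted_list_of_set Z @ [b])"
    using assms by (simp only: list.set set_append set_sorted_list_of_set) auto
qed (rule sorted_sorted_list_of_set distinct_sorted_list_of_set)+

lemma lgl_list:
  assumes "N \<ge> 2"
  shows "sorted_list_of_set {x. poly ([:1, 0, -1:] * pderiv (legendre N)) x = 0} =
    -1 # sorted_list_of_set {x. poly (pderiv (legendre N)) x = 0} @ [1]"
    (is "sorted_list_of_set ?A = -1 # sorted_list_of_set ?Z @ [1]")
proof -
  have "1 - x * x = 0 \<longleftrightarrow> x = -1 \<or> x = 1" for x :: real
    by (metis right_minus_eq square_eq_1_iff)
  then have "?A = insert (-1) (insert 1 ?Z)"
    by auto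
  then show ?thesis
    using sorted_list_of_set_add_bounds[of ?Z "-1" 1] pderiv_legendre_roots[OF assms] by simp
qed

lemma lgl_0:
  assumes "N \<ge> 2"
  shows "lgl N 0 = -1"
  by (simp only: lgl_def lgl_list[OF assms]) simp

lemma lgl_interior_eq_nth:
  assumes "N \<ge> 2" "i < N - 1"
  shows "lgl N (Suc i) = sorted_list_of_set {x. poly (pderiv (legendre N)) x = 0} ! i"
  using assms pderiv_legendre_roots[OF assms(1)]
  by (simp only: lgl_def lgl_list) (simp add: nth_append)

lemma lgl_N:
  assumes "N \<ge> 2"
  shows "lgl N N = 1"
proof -
  have "N = Suc (N - 1)" using assms by simp
  then show ?thesis
    using pderiv_legendre_roots[OF assms]
    by (simp only: lgl_def lgl_list[OF assms]) (simp add: nth_append)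
qed

lemma lgl_interior:
  assumes "N \<ge> 2" "i < N - 1"
  shows "poly (pderiv (legendre N)) (lgl N (Suc i)) = 0" "lgl N (Suc i) \<in> {-1<..<1}"
proof -
  let ?Z = "{x. poly (pderiv (legendre N)) x = 0}"
  note Z = pderiv_legendre_roots[OF assms(1)]
  have "lgl N (Suc i) \<in> set (sorted_list_of_set ?Z)"
    unfolding lgl_interior_eq_nth[OF assms] using assms Z by (intro nth_mem) simp
  then have "lgl N (Suc i) \<in> ?Z"
    using Z by simp
  then show "poly (pderiv (legendre N)) (lgl N (Suc i)) = 0" "lgl N (Suc i) \<in> {-1<..<1}"
    using Z(1) by auto
qed

lemma inj_on_lgl:
  assumes "N \<ge> 2"
  shows "inj_on (lgl N) {..N}"
proof -
  let ?A = "{x. poly ([:1, 0, -1:] * pderiv (legendre N)) x = 0}"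
  have "length (sorted_list_of_set ?A) = Suc N"
    unfolding lgl_list[OF assms] using pderiv_legendre_roots[OF assms] assms by simp
  then have "inj_on (\<lambda>j. sorted_list_of_set ?A ! j) {..N}"
    by (intro inj_on_nth) auto
  then show ?thesis
    by (simp add: lgl_def[abs_def])
qed

section \<open>Interpolation and Gauss quadrature\<close>

lemma poly_eq_on_nodes:
  fixes p q :: "'a :: idom poly"
  assumes "inj_on x A" "finite A" "Polynomial.degree p < card A" "Polynomial.degree q < card A"
    and "\<And>i. i \<in> A \<Longrightarrow> poly p (x i) = poly q (x i)"
  shows "p = q"
  using assms by (intro poly_eqI_degree[of "x ` A"]) (auto simp: card_image)

text \<open>Stated for any node set because it serves twice: all \<open>N + 1\<close> nodes for
  \<open>lagrange\<close>, and only the \<open>N - 1\<close> interior ones for the quadrature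
  weights.\<close>

lemma lagrange_exists:
  fixes x :: "nat \<Rightarrow> 'a :: field"
  assumes "inj_on x A" "finite A" "j \<in> A"
  shows "\<exists>p. Polynomial.degree p < card A \<and> (\<forall>i\<in>A. poly p (x i) = of_bool (i = j))"
proof -
  let ?p = "\<Prod>i\<in>A - {j}. Polynomial.smult (1 / (x j - x i)) [:- x i, 1:]"
  have ne: "x j \<noteq> x i" if "i \<in> A - {j}" for i
    using assms that by (auto dest: inj_onD)
  have "Polynomial.degree ?p \<le> (\<Sum>i\<in>A - {j}. 1)"
    using assms(2) by (intro order.trans[OF degree_prod_sum_le] sum_mono) (auto intro: order.trans[OF degree_smult_le])
  also have "\<dots> < card A"
    using card_Diff1_less[OF assms(2,3)] by simp
  finally have "Polynomial.degree ?p < card A" .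
  moreover have "poly ?p (x j) = 1"
    unfolding poly_prod
  proof (intro prod.neutral ballI)
    fix i assume "i \<in> A - {j}"
    then have "x j - x i \<noteq> 0" using ne by simp
    moreover have "poly [:- x i, 1:] (x j) = x j - x i" by simp
    ultimately show "poly (Polynomial.smult (1 / (x j - x i)) [:- x i, 1:]) (x j) = 1"
      by (simp only: poly_smult) simp
  qed
  moreover have "poly ?p (x i) = 0" if "i \<in> A - {j}" for i
    unfolding poly_prod using assms(2) that by (intro prod_zero) auto
  ultimately show ?thesis
    by (intro exI[of _ ?p]) auto
qed

lemma lagrange_props:
  assumes "N \<ge> 2" "j \<le> N"
  shows "Polynomial.degree (lagrange N j) \<le> N"
    and "\<And>i. i \<le> N \<Longrightarrow> poly (lagrange N j) (lgl N i) = of_bool (i = j)"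
proof -
  have ex: "\<exists>p. Polynomial.degree p \<le> N \<and> (\<forall>i\<le>N. poly p (lgl N i) = of_bool (i = j))"
    using lagrange_exists[OF inj_on_lgl[OF assms(1)], of j] assms by (auto simp: less_Suc_eq_le)
  have "\<exists>!p. Polynomial.degree p \<le> N \<and> (\<forall>i\<le>N. poly p (lgl N i) = of_bool (i = j))"
    by (rule ex_ex1I[OF ex], rule poly_eq_on_nodes[OF inj_on_lgl[OF assms(1)]]) auto
  from theI'[OF this]
  show "Polynomial.degree (lagrange N j) \<le> N"
    and "\<And>i. i \<le> N \<Longrightarrow> poly (lagrange N j) (lgl N i) = of_bool (i = j)"
    unfolding lagrange_def by auto
qed

text \<open>Gauss' argument for the weight 1 - x^2: after division of \<open>h\<close> by
  \<open>P\<close>, whose roots are the nodes, the quotient part integrates to 0 by orthogonality,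
  and the remainder is recovered exactly from its nodal values. Thus \<open>N - 1\<close> nodes
  reach degree 2N - 3.\<close>

lemma gauss_quadrature:
  assumes N: "N \<ge> 2"
  obtains v :: "nat \<Rightarrow> real" where "\<And>j. j < N - 1 \<Longrightarrow> 0 < v j"
    and "\<And>h. Polynomial.degree h < 2 * (N - 1) \<Longrightarrow>
      poly_integral ([:1, 0, -1:] * h) = (\<Sum>j<N-1. v j * poly h (lgl N (Suc j)))"
proof -
  define x where "x = (\<lambda>j. lgl N (Suc j))"
  define P where "P = pderiv (legendre N)"
  define I where "I = (\<lambda>h. poly_integral ([:1, 0, -1:] * h))"
  have I_add: "I (p + q) = I p + I q" and I_smult: "I (Polynomial.smult k p) = k * I p" 
    and I_sum: "I (sum f A) = (\<Sum>i\<in>A. I (f i))" for p q k and f :: "nat \<Rightarrow> real poly" and A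
    unfolding I_def
    by (simp_all only: distrib_left poly_integral_add mult_smult_right poly_integral_smult
        sum_distrib_left poly_integral_sum)
  have inj: "inj_on x {..<N-1}"
    unfolding x_def by (intro inj_onI, drule inj_onD[OF inj_on_lgl[OF N]]) auto
  have "\<exists>g. \<forall>j<N-1. Polynomial.degree (g j) < N - 1 \<and> (\<forall>i<N-1. poly (g j) (x i) = of_bool (i = j))"
    using lagrange_exists[OF inj] by (subst choice_iff'[symmetric]) (simp add: Ball_def)
  then obtain g where g: "\<And>j. j < N-1 \<Longrightarrow> Polynomial.degree (g j) < N - 1"
      "\<And>j i. j < N - 1 \<Longrightarrow> i < N-1 \<Longrightarrow> poly (g j) (x i) = of_bool (i = j)"
    by blast
  have exact: "I h = (\<Sum>j<N-1. I (g j) * poly h (x j))" if h: "Polynomial.degree h < 2 * (N - 1)" for h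
  proof -
    have dP: "Polynomial.degree P = N - 1"
      unfolding P_def by (rule degree_pderiv_legendre)
    then have "P \<noteq> 0"
      using N by auto
    define q r where "q = h div P" and "r = h mod P"
    have hqr: "h = P * q + r"
      by (simp add: q_def r_def)
    have dr: "Polynomial.degree r < N - 1"
      using degree_mod_less'[of P h] dP \<open>P \<noteq> 0\<close> N unfolding r_def
      by (cases "h mod P = 0") auto
    have "Suc (Polynomial.degree q) < N"
    proof (cases "q = 0")
      case False
      have "Polynomial.degree (P * q) < 2 * (N - 1)"
      proof -
        have "P * q = h - r" using hqr by simp
        then show ?thesis
          using h dr degree_diff_less[of h "2 * (N - 1)" r] by simp
      qed
      then show ?thesis
        using False \<open>P \<noteq> 0\<close> dP by (simp add: degree_mult_eq)
    qed (use N in auto)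
    then have "I (P * q) = 0"
      unfolding I_def P_def by (rule pderiv_legendre_orthogonal)
    then have Ihr: "I h = I r"
      unfolding hqr I_add by simp
    have hx: "poly h (x j) = poly r (x j)" if "j < N - 1" for j
      using lgl_interior(1)[OF N that] unfolding hqr x_def P_def by simp
    have r: "r = (\<Sum>j<N-1. Polynomial.smult (poly h (x j)) (g j))"
    proof (rule poly_eq_on_nodes[OF inj])
      show "Polynomial.degree (\<Sum>j<N-1. Polynomial.smult (poly h (x j)) (g j)) < card {..<N-1}"
        using N g(1) by (simp, intro degree_sum_less) (auto intro: le_less_trans[OF degree_smult_le])
      show "poly r (x i) = poly (\<Sum>j<N-1. Polynomial.smult (poly h (x j)) (g j)) (x i)"
        if "i \<in> {..<N-1}" for i
      proof -
        have "poly (\<Sum>j<N-1. Polynomial.smult (poly h (x j)) (g j)) (x i) =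
            (\<Sum>j<N-1. if j = i then poly h (x j) else 0)"
          unfolding poly_sum using that g(2) by (intro sum.cong) auto
        then show ?thesis using that hx by simp
      qed
    qed (use dr in auto)
    show ?thesis
      unfolding Ihr by (subst r) (simp only: I_sum I_smult mult.commute)
  qed
  have "0 < I (g j)" if j: "j < N - 1" for j
  proof -
    have "g j \<noteq> 0"
      using g(2)[OF j j] by auto
    \<comment> \<open>The square has degree at most 2N - 4, so the rule is exact for it, and its
      nodal values are those of \<open>g j\<close>. This makes the weight \<open>I (g j)\<close> the
      integral of a nonnegative function.\<close>
    have "I (g j * g j) = I (g j)"
    proof -
      have "Polynomial.degree (g j * g j) < 2 * (N - 1)"
        using degree_mult_le[of "g j" "g j"] g(1)[OF j] by linarith
      then have "I (g j * g j) = (\<Sum>i<N-1. I (g i) * poly (g j * g j) (x i))"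
        by (rule exact)
      also have "\<dots> = (\<Sum>i<N-1. if i = j then I (g i) else 0)"
        using g(2)[OF j] by (intro sum.cong) auto
      finally show ?thesis using j by simp
    qed
    moreover have "0 < I (g j * g j)"
      unfolding I_def
    proof (rule poly_integral_pos)
      fix t :: real assume "t \<in> {-1..1}"
      then have "t * t \<le> 1"
        by (auto simp: abs_le_iff power2_eq_square[symmetric] abs_square_le_1)
      moreover have "poly ([:1, 0, -1:] * (g j * g j)) t = (1 - t * t) * (poly (g j) t)\<^sup>2"
        by (simp add: power2_eq_square algebra_simps)
      ultimately show "0 \<le> poly ([:1, 0, -1:] * (g j * g j)) t"
        by simp
    qed (use \<open>g j \<noteq> 0\<close> in \<open>simp only: mult_eq_0_iff, simp\<close>)
    ultimately show ?thesis by simp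
  qed
  moreover have "poly_integral ([:1, 0, -1:] * h) = (\<Sum>j<N-1. I (g j) * poly h (lgl N (Suc j)))"
    if "Polynomial.degree h < 2 * (N - 1)" for h
    using exact[OF that] unfolding I_def x_def .
  ultimately show thesis
    by (rule that)
qed

section \<open>Discrete integration by parts and the form of the differentiation matrix\<close>

lemma degree_pderiv2: "Polynomial.degree (pderiv (pderiv (p :: real poly))) = Polynomial.degree p - 2"
  by (simp add: degree_pderiv)

lemma double_root_factor:
  fixes q :: "real poly"
  assumes "poly q 1 = 0" "poly q (-1) = 0"
  obtains s where "q = [:1, 0, -1:] * s" "Polynomial.degree s \<le> Polynomial.degree q - 2"
proof (cases "q = 0")
  case True
  then show thesis using that[of 0] by simp
next
  case False
  obtain r where r: "q = [:-1, 1:] * r"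
    using assms(1) by (metis dvdE poly_eq_0_iff_dvd)
  then obtain s where s: "r = [:-(-1), 1:] * s"
    using assms(2) by (auto simp: poly_eq_0_iff_dvd)
  have q: "q = [:1, 0, -1:] * (- s)"
    unfolding r s by simp
  then have "Polynomial.degree q = 2 + Polynomial.degree s"
    using False by (subst q, subst degree_mult_eq) auto
  then show thesis
    using that[OF q] by simp
qed

text \<open>Since \<open>q\<close> vanishes at both ends it splits off 1 - x^2, and p'' times the
  cofactor has degree at most 2N - 4, within reach of the Gauss rule. Dividing the Gauss weights by
  1 - x_j^2 > 0 turns values of the cofactor into values of \<open>q\<close>. Integration by parts
  then makes the right side symmetric in \<open>p\<close> and \<open>q\<close>.\<close>

lemma lgl_weights:
  assumes N: "N \<ge> 2"
  obtains w :: "nat \<Rightarrow> real" where "\<And>j. j < N - 1 \<Longrightarrow> 0 < w j"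
    and "\<And>p q. \<lbrakk>Polynomial.degree p \<le> N; Polynomial.degree q \<le> N; poly p 1 = 0; poly p (-1) = 0;
      poly q 1 = 0; poly q (-1) = 0\<rbrakk> \<Longrightarrow>
      (\<Sum>j<N-1. w j * poly (pderiv (pderiv p)) (lgl N (Suc j)) * poly q (lgl N (Suc j))) =
      - poly_integral (pderiv p * pderiv q)"
proof -
  obtain v where v: "\<And>j. j < N - 1 \<Longrightarrow> 0 < v j"
    and exact: "\<And>h. Polynomial.degree h < 2 * (N - 1) \<Longrightarrow>
      poly_integral ([:1, 0, -1:] * h) = (\<Sum>j<N-1. v j * poly h (lgl N (Suc j)))"
    by (rule gauss_quadrature[OF N]) (rule that)
  define x where "x = (\<lambda>j. lgl N (Suc j))"
  have x: "0 < 1 - x j * x j" if "j < N - 1" for j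
  proof -
    have "\<bar>x j\<bar> < 1"
      using lgl_interior(2)[OF N that] by (auto simp: x_def)
    then show ?thesis
      by (simp add: power2_eq_square[symmetric] abs_square_less_1)
  qed
  show thesis
  proof (rule that[of "\<lambda>j. v j / (1 - x j * x j)"])
    show "0 < v j / (1 - x j * x j)" if "j < N - 1" for j
      using v x that by simp
    fix p q :: "real poly"
    assume pq: "Polynomial.degree p \<le> N" "Polynomial.degree q \<le> N" "poly p 1 = 0" "poly p (-1) = 0"
      "poly q 1 = 0" "poly q (-1) = 0"
    obtain s where s: "q = [:1, 0, -1:] * s" "Polynomial.degree s \<le> Polynomial.degree q - 2"
      using double_root_factor[OF pq(5,6)] by blast
    let ?h = "pderiv (pderiv p) * s"
    have "Polynomial.degree ?h < 2 * (N - 1)"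
      using degree_mult_le[of "pderiv (pderiv p)" s] degree_pderiv2[of p] s(2) pq(1,2) N by linarith
    from exact[OF this]
    have "poly_integral (pderiv (pderiv p) * q) = (\<Sum>j<N-1. v j * poly ?h (x j))"
      unfolding s(1) x_def by (simp only: mult.left_commute)
    also have "\<dots> = (\<Sum>j<N-1. v j / (1 - x j * x j) * poly (pderiv (pderiv p)) (x j) * poly q (x j))"
    proof (rule sum.cong[OF refl])
      fix j assume "j \<in> {..<N-1}"
      then have "1 - x j * x j \<noteq> 0" using x[of j] by simp
      moreover have "poly q (x j) = (1 - x j * x j) * poly s (x j)"
        unfolding s(1) by (simp add: algebra_simps)
      ultimately show "v j * poly ?h (x j) =
          v j / (1 - x j * x j) * poly (pderiv (pderiv p)) (x j) * poly q (x j)"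
        by simp
    qed
    finally show "(\<Sum>j<N-1. v j / (1 - x j * x j) * poly (pderiv (pderiv p)) (lgl N (Suc j)) *
        poly q (lgl N (Suc j))) = - poly_integral (pderiv p * pderiv q)"
      using poly_integral_by_parts[of "pderiv p" q] pq(5,6) by (simp add: x_def)
  qed
qed

text \<open>The basis polynomials of the two endpoints are left out, which builds in the boundary
  condition. On nodal values, \<open>D2\<close> acts as the second derivative of this
  polynomial.\<close>

definition interpolant :: "nat \<Rightarrow> (nat \<Rightarrow> real) \<Rightarrow> real poly" where
  "interpolant N u = (\<Sum>j<N-1. Polynomial.smult (u j) (lagrange N (Suc j)))"

lemma interpolant_props:
  assumes N: "N \<ge> 2"
  shows "Polynomial.degree (interpolant N u) \<le> N"
    and "poly (interpolant N u) 1 = 0" "poly (interpolant N u) (-1) = 0"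
    and "i < N - 1 \<Longrightarrow> poly (interpolant N u) (lgl N (Suc i)) = u i"
    and "i < N - 1 \<Longrightarrow> poly (pderiv (pderiv (interpolant N u))) (lgl N (Suc i)) =
      (\<Sum>j<N-1. D2 N $$ (i, j) * u j)"
proof -
  note L = lagrange_props[OF N]
  show "Polynomial.degree (interpolant N u) \<le> N"
    unfolding interpolant_def using L(1)
    by (intro degree_sum_le) (auto intro: order.trans[OF degree_smult_le])
  show "poly (interpolant N u) 1 = 0"
    unfolding interpolant_def poly_sum using L(2)[of _ N] lgl_N[OF N] by (intro sum.neutral) auto
  show "poly (interpolant N u) (-1) = 0"
    unfolding interpolant_def poly_sum using L(2)[of _ 0] lgl_0[OF N] by (intro sum.neutral) auto
  show "poly (interpolant N u) (lgl N (Suc i)) = u i" if "i < N - 1"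
  proof -
    have "poly (interpolant N u) (lgl N (Suc i)) = (\<Sum>j<N-1. if j = i then u j else 0)"
      unfolding interpolant_def poly_sum using that L(2)[of _ "Suc i"] by (intro sum.cong) auto
    then show ?thesis using that by simp
  qed
  show "poly (pderiv (pderiv (interpolant N u))) (lgl N (Suc i)) = (\<Sum>j<N-1. D2 N $$ (i, j) * u j)"
    if "i < N - 1"
    using that by (simp add: interpolant_def pderiv_sum pderiv_smult poly_sum D2_def mult.commute)
qed

lemma interpolant_eqI:
  assumes N: "N \<ge> 2" and "Polynomial.degree p \<le> N" "poly p 1 = 0" "poly p (-1) = 0"
  shows "p = interpolant N (\<lambda>j. poly p (lgl N (Suc j)))"
proof (rule poly_eq_on_nodes[OF inj_on_lgl[OF N]])
  fix i assume i: "i \<in> {..N}"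
  let ?q = "interpolant N (\<lambda>j. poly p (lgl N (Suc j)))"
  consider "i = 0" | "i = N" | j where "i = Suc j" "j < N - 1"
    using i by (cases i) force+
  then show "poly p (lgl N i) = poly ?q (lgl N i)"
    by cases (simp_all add: assms(3,4) lgl_0[OF N] lgl_N[OF N] interpolant_props[OF N])
qed (use assms interpolant_props(1)[OF N] in \<open>auto simp: less_Suc_eq_le\<close>)

lemma D2_weighted_symmetric_negative:
  assumes N: "N \<ge> 2"
  obtains w :: "nat \<Rightarrow> real" where "\<And>i. i < N - 1 \<Longrightarrow> 0 < w i"
    and "\<And>i j. \<lbrakk>i < N - 1; j < N - 1\<rbrakk> \<Longrightarrow> w i * D2 N $$ (i, j) = w j * D2 N $$ (j, i)"
    and "\<And>u i. \<lbrakk>i < N - 1; u i \<noteq> 0\<rbrakk> \<Longrightarrow> (\<Sum>i<N-1. \<Sum>j<N-1. w i * D2 N $$ (i, j) * u i * u j) < 0"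
proof -
  obtain w where w: "\<And>j. j < N - 1 \<Longrightarrow> 0 < w j"
    and form: "\<And>p q. \<lbrakk>Polynomial.degree p \<le> N; Polynomial.degree q \<le> N; poly p 1 = 0; poly p (-1) = 0;
      poly q 1 = 0; poly q (-1) = 0\<rbrakk> \<Longrightarrow>
      (\<Sum>j<N-1. w j * poly (pderiv (pderiv p)) (lgl N (Suc j)) * poly q (lgl N (Suc j))) =
      - poly_integral (pderiv p * pderiv q)"
    by (rule lgl_weights[OF N]) (rule that)
  have form': "(\<Sum>i<N-1. w i * (\<Sum>j<N-1. D2 N $$ (i, j) * u j) * v i) =
      - poly_integral (pderiv (interpolant N u) * pderiv (interpolant N v))" for u v
    using form[of "interpolant N u" "interpolant N v"] interpolant_props[OF N] by simp
  show thesis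
  proof (rule that)
    show "0 < w i" if "i < N - 1" for i using w that .
    show "w i * D2 N $$ (i, j) = w j * D2 N $$ (j, i)" if ij: "i < N - 1" "j < N - 1" for i j
    proof -
      \<comment> \<open>Testing the form with unit vectors reads off single entries, so the symmetry
        of the integral becomes symmetry of the weighted matrix.\<close>
      have e: "(\<Sum>i<N-1. w i * (\<Sum>j<N-1. D2 N $$ (i, j) * of_bool (j = b)) * of_bool (i = a)) =
          w a * D2 N $$ (a, b)" if "a < N - 1" "b < N - 1" for a b
        using that by (simp add: of_bool_def if_distrib[of "(*) _"] sum.delta cong: if_cong)
      show ?thesis
        using form'[of "\<lambda>k. of_bool (k = j)" "\<lambda>k. of_bool (k = i)"]
          form'[of "\<lambda>k. of_bool (k = i)" "\<lambda>k. of_bool (k = j)"]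
        unfolding e[OF ij] e[OF ij(2,1)] by (simp add: mult.commute)
    qed
    fix u :: "nat \<Rightarrow> real" and i assume i: "i < N - 1" "u i \<noteq> 0"
    let ?p = "interpolant N u"
    \<comment> \<open>A constant interpolant would be 0 by its value at 1, contradicting its value
      \<open>u i\<close> at a node.\<close>
    have "pderiv ?p \<noteq> 0"
    proof
      assume "pderiv ?p = 0"
      then obtain c where "?p = [:c:]"
        by (metis pderiv_eq_0_iff degree_eq_zeroE)
      then show False
        using interpolant_props(2)[OF N, of u] interpolant_props(4)[OF N i(1), of u] i(2) by simp
    qed
    then have "0 < poly_integral (pderiv ?p * pderiv ?p)"
      by (intro poly_integral_pos) auto
    then show "(\<Sum>i<N-1. \<Sum>j<N-1. w i * D2 N $$ (i, j) * u i * u j) < 0"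
      using form'[of u u] by (simp add: sum_distrib_left sum_distrib_right mult.assoc mult.left_commute mult.commute)
  qed
qed

section \<open>Rayleigh quotients\<close>

lemma mat_inverse_nonsingular:
  fixes A :: "'a :: field mat"
  assumes A: "A \<in> carrier_mat n n" and "det A \<noteq> 0"
  shows "the (mat_inverse A) \<in> carrier_mat n n"
    and "A * the (mat_inverse A) = 1\<^sub>m n" and "the (mat_inverse A) * A = 1\<^sub>m n"
proof -
  have "mat_inverse A \<noteq> None"
    using mat_inverse(1)[OF A] det_non_zero_imp_unit[OF A assms(2)] by metis
  then obtain B where "mat_inverse A = Some B" by auto
  with mat_inverse(2)[OF A this]
  show "the (mat_inverse A) \<in> carrier_mat n n"
    and "A * the (mat_inverse A) = 1\<^sub>m n" and "the (mat_inverse A) * A = 1\<^sub>m n"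
    by auto
qed

lemma invertible_mat_nonsingular:
  fixes A :: "'a :: field mat"
  assumes A: "A \<in> carrier_mat n n" and "det A \<noteq> 0"
  shows "invertible_mat A"
  using mat_inverse_nonsingular[OF assms] A by (auto simp: invertible_mat_def inverts_mat_def)

lemma index_mult_mat_vec_sum:
  assumes "A \<in> carrier_mat n m" "v \<in> carrier_vec m" "i < n"
  shows "(A *\<^sub>v v) $ i = (\<Sum>j<m. A $$ (i, j) * v $ j)"
  using assms by (simp add: scalar_prod_def atLeast0LessThan)

lemma index_mult_mat_sum:
  assumes "A \<in> carrier_mat n m" "B \<in> carrier_mat m k" "i < n" "j < k"
  shows "(A * B) $$ (i, j) = (\<Sum>l<m. A $$ (i, l) * B $$ (l, j))"
  using assms by (simp add: scalar_prod_def atLeast0LessThan)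

text \<open>Each product is bounded by x_i^2 + x_j^2, and each square by the whole weighted sum
  divided by its own weight. Any constant will do; it supplies the boundedness used in the
  coercivity and infimum arguments.\<close>

lemma quadratic_form_bounded:
  fixes w :: "nat \<Rightarrow> real"
  assumes w: "\<And>i. i < n \<Longrightarrow> 0 < w i"
  obtains C where "0 < C"
    and "\<And>x :: nat \<Rightarrow> real. \<bar>\<Sum>i<n. \<Sum>j<n. g i j * x i * x j\<bar> \<le> C * (\<Sum>i<n. w i * (x i)\<^sup>2)"
proof
  \<comment> \<open>The summand 1 keeps the constant positive even if \<open>g\<close>
    vanishes.\<close>
  let ?C = "1 + (\<Sum>i<n. \<Sum>j<n. \<bar>g i j\<bar> * (1 / w i + 1 / w j))"
  have "0 \<le> (\<Sum>i<n. \<Sum>j<n. \<bar>g i j\<bar> * (1 / w i + 1 / w j))"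
    using w by (intro sum_nonneg mult_nonneg_nonneg add_nonneg_nonneg) (auto simp: less_imp_le)
  then show "0 < ?C"
    by linarith
  fix x :: "nat \<Rightarrow> real"
  let ?s = "\<Sum>i<n. w i * (x i)\<^sup>2"
  have s0: "0 \<le> ?s"
    using w by (intro sum_nonneg) (auto simp: less_imp_le)
  have sq: "(x i)\<^sup>2 \<le> ?s / w i" if "i < n" for i
  proof -
    have "w i * (x i)\<^sup>2 \<le> ?s"
      using w that by (intro member_le_sum[of i]) (auto simp: less_imp_le)
    then show ?thesis
      using w[OF that] by (simp add: field_simps)
  qed
  have "\<bar>\<Sum>i<n. \<Sum>j<n. g i j * x i * x j\<bar> \<le> (\<Sum>i<n. \<Sum>j<n. \<bar>g i j * x i * x j\<bar>)"
    by (rule order.trans[OF sum_abs]) (intro sum_mono sum_abs)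
  also have "\<dots> \<le> (\<Sum>i<n. \<Sum>j<n. \<bar>g i j\<bar> * (1 / w i + 1 / w j) * ?s)"
  proof (intro sum_mono)
    fix i j assume ij: "i \<in> {..<n}" "j \<in> {..<n}"
    have "0 \<le> (\<bar>x i\<bar> - \<bar>x j\<bar>)\<^sup>2 + (x i)\<^sup>2 + (x j)\<^sup>2" by simp
    then have "\<bar>x i\<bar> * \<bar>x j\<bar> \<le> (x i)\<^sup>2 + (x j)\<^sup>2"
      by (simp add: power2_diff)
    also have "\<dots> \<le> (1 / w i + 1 / w j) * ?s"
      using sq[of i] sq[of j] ij by (simp add: distrib_right)
    finally show "\<bar>g i j * x i * x j\<bar> \<le> \<bar>g i j\<bar> * (1 / w i + 1 / w j) * ?s"
      by (simp add: abs_mult mult.assoc mult_left_mono)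
  qed
  also have "\<dots> = (\<Sum>i<n. \<Sum>j<n. \<bar>g i j\<bar> * (1 / w i + 1 / w j)) * ?s"
    by (simp only: sum_distrib_right)
  also have "\<dots> \<le> ?C * ?s"
    using s0 by (intro mult_right_mono) auto
  finally show "\<bar>\<Sum>i<n. \<Sum>j<n. g i j * x i * x j\<bar> \<le> ?C * ?s" .
qed

text \<open>With $z = A^{-1} x$, minimise $\langle A (x - t z), x - t z \rangle \ge 0$ over the step length $t$.\<close>

lemma nonsingular_semidefinite_imp_coercive:
  fixes A :: "real mat" and w :: "nat \<Rightarrow> real"
  assumes A: "A \<in> carrier_mat n n" and w: "\<And>i. i < n \<Longrightarrow> 0 < w i"
    and sym: "\<And>i j. \<lbrakk>i < n; j < n\<rbrakk> \<Longrightarrow> w i * A $$ (i, j) = w j * A $$ (j, i)"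
    and psd: "\<And>x :: nat \<Rightarrow> real. 0 \<le> (\<Sum>i<n. \<Sum>j<n. w i * A $$ (i, j) * x i * x j)"
    and "det A \<noteq> 0"
  obtains \<delta> where "0 < \<delta>"
    and "\<And>x :: nat \<Rightarrow> real. \<delta> * (\<Sum>i<n. w i * (x i)\<^sup>2) \<le> (\<Sum>i<n. \<Sum>j<n. w i * A $$ (i, j) * x i * x j)"
proof -
  define K where "K = the (mat_inverse A)"
  have K: "K \<in> carrier_mat n n" "A * K = 1\<^sub>m n"
    using mat_inverse_nonsingular[OF A] assms(5) by (simp_all add: K_def)
  obtain C where C: "0 < C" and
    bound: "\<And>x :: nat \<Rightarrow> real. \<bar>\<Sum>i<n. \<Sum>j<n. (w i * K $$ (i, j)) * x i * x j\<bar> \<le> C * (\<Sum>i<n. w i * (x i)\<^sup>2)"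
    by (rule quadratic_form_bounded[OF w, where g = "\<lambda>i j. w i * K $$ (i, j)"]) (assumption, rule that)
  define f where "f = (\<lambda>x y. \<Sum>i<n. \<Sum>j<n. w i * A $$ (i, j) * x i * y j)"
  have f_sym: "f x y = f y x" for x y
  proof -
    have "f x y = (\<Sum>j<n. \<Sum>i<n. w i * A $$ (i, j) * x i * y j)"
      unfolding f_def by (rule sum.swap)
    also have "\<dots> = f y x"
      unfolding f_def using sym by (intro sum.cong refl) (simp add: mult.assoc mult.left_commute)
    finally show ?thesis .
  qed
  have f_diff: "f (\<lambda>i. x i - t * z i) (\<lambda>i. x i - t * z i) = f x x - t * f x z - t * f z x + t\<^sup>2 * f z z" for x z t
    unfolding f_def by (simp add: algebra_simps sum.distrib sum_subtractf sum_distrib_left power2_eq_square)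
  have key: "(1 / C) * (\<Sum>i<n. w i * (x i)\<^sup>2) \<le> f x x" for x
  proof -
    let ?s = "\<Sum>i<n. w i * (x i)\<^sup>2"
    define z where "z = (\<lambda>i. \<Sum>j<n. K $$ (i, j) * x j)"
    have Az: "(\<Sum>l<n. A $$ (i, l) * z l) = x i" if "i < n" for i
    proof -
      have "(\<Sum>l<n. A $$ (i, l) * z l) = (\<Sum>j<n. (\<Sum>l<n. A $$ (i, l) * K $$ (l, j)) * x j)"
        unfolding z_def sum_distrib_left sum_distrib_right mult.assoc by (rule sum.swap)
      also have "\<dots> = (\<Sum>j<n. (A * K) $$ (i, j) * x j)"
        using that by (intro sum.cong refl) (simp add: index_mult_mat_sum[OF A K(1)])
      also have "\<dots> = (\<Sum>j<n. if j = i then x j else 0)"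
        unfolding K(2) using that by (intro sum.cong refl) auto
      finally show ?thesis using that by simp
    qed
    have f_z: "f y z = (\<Sum>i<n. w i * y i * x i)" for y
    proof -
      have "f y z = (\<Sum>i<n. w i * y i * (\<Sum>l<n. A $$ (i, l) * z l))"
        unfolding f_def sum_distrib_left by (intro sum.cong refl) (simp add: mult_ac)
      also have "\<dots> = (\<Sum>i<n. w i * y i * x i)"
        by (intro sum.cong refl) (simp add: Az)
      finally show ?thesis .
    qed
    have "f x z = ?s"
      unfolding f_z by (simp add: power2_eq_square mult.assoc)
    moreover have "f z z \<le> C * ?s"
    proof -
      have "f z z = (\<Sum>i<n. \<Sum>j<n. (w i * K $$ (i, j)) * x i * x j)"
        unfolding f_z unfolding z_def sum_distrib_left sum_distrib_right
        by (intro sum.cong refl) (simp add: mult_ac)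
      then show ?thesis using bound[of x] by linarith
    qed
    \<comment> \<open>With \<open>f x z = ?s\<close> and \<open>f z z \<le> C * ?s\<close>, the
      bound \<open>f x x - 2 * t * ?s + t^2 * C * ?s\<close> is smallest at
      \<open>t = 1 / C\<close>, where it equals \<open>f x x - ?s / C\<close>.\<close>
    moreover have "0 \<le> f (\<lambda>i. x i - 1 / C * z i) (\<lambda>i. x i - 1 / C * z i)"
      unfolding f_def by (rule psd)
    ultimately have "0 \<le> f x x - 2 * (1 / C * ?s) + (1 / C)\<^sup>2 * f z z" and "(1 / C)\<^sup>2 * f z z \<le> (1 / C)\<^sup>2 * (C * ?s)"
      unfolding f_diff f_sym[of z x] by (simp, intro mult_left_mono) auto
    moreover have "(1 / C)\<^sup>2 * (C * ?s) = 1 / C * ?s"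
      using C by (simp add: power2_eq_square)
    ultimately show ?thesis by linarith
  qed
  show thesis
    by (rule that[of "1 / C"]) (use C key in \<open>auto simp: f_def\<close>)
qed

text \<open>If the infimum $R$ of the Rayleigh quotient were not an eigenvalue, $D - R$ would be nonsingular and
  semidefinite, hence coercive, and $R$ could be increased; no compactness is needed.\<close>

lemma rayleigh_lower:
  fixes D :: "real mat" and w :: "nat \<Rightarrow> real"
  assumes D: "D \<in> carrier_mat n n" and w: "\<And>i. i < n \<Longrightarrow> 0 < w i"
    and sym: "\<And>i j. \<lbrakk>i < n; j < n\<rbrakk> \<Longrightarrow> w i * D $$ (i, j) = w j * D $$ (j, i)"
    and ev: "\<And>k. eigenvalue D k \<Longrightarrow> m \<le> k"
  shows "m * (\<Sum>i<n. w i * (x i)\<^sup>2) \<le> (\<Sum>i<n. \<Sum>j<n. w i * D $$ (i, j) * x i * x j)"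
proof (rule ccontr)
  define s where "s = (\<lambda>x :: nat \<Rightarrow> real. \<Sum>i<n. w i * (x i)\<^sup>2)"
  define q where "q = (\<lambda>x :: nat \<Rightarrow> real. \<Sum>i<n. \<Sum>j<n. w i * D $$ (i, j) * x i * x j)"
  assume "\<not> ?thesis"
  then have less: "q x < m * s x" by (simp add: s_def q_def)
  obtain C where C: "0 < C" "\<And>x. \<bar>q x\<bar> \<le> C * s x"
    by (rule quadratic_form_bounded[OF w, where g = "\<lambda>i j. w i * D $$ (i, j)"])
      (assumption, rule that, simp_all add: q_def s_def)
  have s0: "0 \<le> s y" for y
    unfolding s_def using w by (intro sum_nonneg) (auto simp: less_imp_le)
  have "s x \<noteq> 0"
    using less C(2)[of x] by auto
  with s0[of x] have sx: "0 < s x" by simp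
  define T where "T = {t. \<forall>y. t * s y \<le> q y}"
  have "- C * s y \<le> q y" for y
    using C(2)[of y] by (simp add: abs_le_iff)
  then have "- C \<in> T" unfolding T_def by blast
  have upper: "t \<le> q y / s y" if "t \<in> T" "0 < s y" for t y
    using that by (simp add: T_def pos_le_divide_eq)
  have bdd: "bdd_above T"
    using upper[OF _ sx] by (intro bdd_aboveI)
  define R where "R = Sup T"
  have RT: "R * s y \<le> q y" for y
  \<comment> \<open>If \<open>s y = 0\<close>, the bound with \<open>C\<close> forces
    \<open>q y = 0\<close>; the quotient is formed only for positive \<open>s y\<close>.\<close>
  proof (cases "s y = 0")
    case True
    then show ?thesis using C(2)[of y] by simp
  next
    case False
    then have "0 < s y" using s0[of y] by simp
    then have "R \<le> q y / s y"
      unfolding R_def using \<open>- C \<in> T\<close> upper by (intro cSup_least) auto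
    then show ?thesis using \<open>0 < s y\<close> by (simp add: pos_le_divide_eq)
  qed
  \<comment> \<open>The vector violating the claim pushes the infimum strictly below
    \<open>m\<close>, hence below every real eigenvalue.\<close>
  have "R < m"
  proof -
    have "R * s x < m * s x" using RT[of x] less by linarith
    then show ?thesis using sx by simp
  qed
  then have "\<not> eigenvalue D R" using ev by force
  then have det: "det (char_matrix D R) \<noteq> 0"
    using eigenvalue_det[OF D] by simp
  have entry: "char_matrix D R $$ (i, j) = D $$ (i, j) - (if i = j then R else 0)" if "i < n" "j < n" for i j
    using D that by (simp add: char_matrix_def)
  have form: "(\<Sum>i<n. \<Sum>j<n. w i * char_matrix D R $$ (i, j) * y i * y j) = q y - R * s y" for y :: "nat \<Rightarrow> real"
  proof -
    have "(\<Sum>i<n. \<Sum>j<n. w i * char_matrix D R $$ (i, j) * y i * y j) =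
        (\<Sum>i<n. (\<Sum>j<n. w i * D $$ (i, j) * y i * y j) - (\<Sum>j<n. if j = i then R * w i * y i * y j else 0))"
      unfolding sum_subtractf[symmetric] by (intro sum.cong refl) (auto simp: entry algebra_simps)
    also have "\<dots> = q y - R * s y"
      by (simp add: q_def s_def sum_subtractf sum_distrib_left power2_eq_square mult.assoc)
    finally show ?thesis .
  qed
  obtain \<delta> where "0 < \<delta>" and \<delta>: "\<And>y. \<delta> * s y \<le> q y - R * s y"
  proof (rule nonsingular_semidefinite_imp_coercive[of "char_matrix D R" n w])
    show "w i * char_matrix D R $$ (i, j) = w j * char_matrix D R $$ (j, i)" if "i < n" "j < n" for i j
      using sym[OF that] that by (simp add: entry algebra_simps)
    show "0 \<le> (\<Sum>i<n. \<Sum>j<n. w i * char_matrix D R $$ (i, j) * y i * y j)" for y :: "nat \<Rightarrow> real"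
      unfolding form using RT[of y] by simp
  qed (use D w det in \<open>auto simp: form s_def\<close>)
  then have "R + \<delta> \<in> T"
    by (simp add: T_def distrib_right) (metis add.commute le_diff_eq)
  then have "R + \<delta> \<le> R"
    unfolding R_def by (rule cSup_upper[OF _ bdd])
  with \<open>0 < \<delta>\<close> show False by simp
qed

lemma rayleigh_upper:
  fixes D :: "real mat" and w :: "nat \<Rightarrow> real"
  assumes D: "D \<in> carrier_mat n n" and w: "\<And>i. i < n \<Longrightarrow> 0 < w i"
    and sym: "\<And>i j. \<lbrakk>i < n; j < n\<rbrakk> \<Longrightarrow> w i * D $$ (i, j) = w j * D $$ (j, i)"
    and ev: "\<And>k. eigenvalue D k \<Longrightarrow> k \<le> m"
  shows "(\<Sum>i<n. \<Sum>j<n. w i * D $$ (i, j) * x i * x j) \<le> m * (\<Sum>i<n. w i * (x i)\<^sup>2)"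
proof -
  have "- m \<le> k" if k: "eigenvalue (- D) k" for k
  proof -
    obtain v where v: "v \<in> carrier_vec n" "v \<noteq> 0\<^sub>v n" "- (D *\<^sub>v v) = k \<cdot>\<^sub>v v"
      using k D unfolding eigenvalue_def eigenvector_def by auto
    have "D *\<^sub>v v = - (k \<cdot>\<^sub>v v)"
      unfolding v(3)[symmetric] by simp
    then have "D *\<^sub>v v = (- k) \<cdot>\<^sub>v v"
      by (auto intro!: eq_vecI)
    then have "eigenvalue D (- k)"
      using v D by (auto simp: eigenvalue_def eigenvector_def)
    from ev[OF this] show ?thesis by simp
  qed
  then have "- m * (\<Sum>i<n. w i * (x i)\<^sup>2) \<le> (\<Sum>i<n. \<Sum>j<n. w i * (- D) $$ (i, j) * x i * x j)"
    using D sym by (intro rayleigh_lower[OF _ w]) auto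
  also have "\<dots> = - (\<Sum>i<n. \<Sum>j<n. w i * D $$ (i, j) * x i * x j)"
    unfolding sum_negf[symmetric] using D by (intro sum.cong refl) simp
  finally show ?thesis by simp
qed

text \<open>The mixed products of real and imaginary parts cancel by symmetry after exchanging the
  sums. Complex vectors thus reduce to two real ones, to which the real Rayleigh bounds
  apply.\<close>

lemma hermitian_form_of_real:
  fixes z :: "nat \<Rightarrow> complex" and g :: "nat \<Rightarrow> nat \<Rightarrow> real"
  assumes sym: "\<And>i j. \<lbrakk>i < n; j < n\<rbrakk> \<Longrightarrow> g i j = g j i"
  shows "(\<Sum>i<n. \<Sum>j<n. of_real (g i j) * cnj (z i) * z j) =
    of_real ((\<Sum>i<n. \<Sum>j<n. g i j * Re (z i) * Re (z j)) + (\<Sum>i<n. \<Sum>j<n. g i j * Im (z i) * Im (z j)))"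
proof (rule complex_eqI)
  have "(\<Sum>i<n. \<Sum>j<n. g i j * Re (z i) * Im (z j)) = (\<Sum>j<n. \<Sum>i<n. g i j * Re (z i) * Im (z j))"
    by (rule sum.swap)
  also have "\<dots> = (\<Sum>i<n. \<Sum>j<n. g i j * Im (z i) * Re (z j))"
    using sym by (intro sum.cong refl) simp
  finally show "Im (\<Sum>i<n. \<Sum>j<n. of_real (g i j) * cnj (z i) * z j) = Im (of_real
      ((\<Sum>i<n. \<Sum>j<n. g i j * Re (z i) * Re (z j)) + (\<Sum>i<n. \<Sum>j<n. g i j * Im (z i) * Im (z j))))"
    by (simp add: sum_subtractf)
qed (simp add: sum.distrib)

section \<open>The energy form of a separable operator\<close>

text \<open>What the energy estimates use of \<open>D2 N\<close>; \<open>w\<close> stands for the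
  interior quadrature weights.\<close>

locale weighted_symmetric_negative =
  fixes n :: nat and D :: "real mat" and w :: "nat \<Rightarrow> real"
  assumes D: "D \<in> carrier_mat n n"
    and w: "i < n \<Longrightarrow> 0 < w i"
    and sym: "\<lbrakk>i < n; j < n\<rbrakk> \<Longrightarrow> w i * D $$ (i, j) = w j * D $$ (j, i)"
    and neg: "\<lbrakk>i < n; u i \<noteq> 0\<rbrakk> \<Longrightarrow> (\<Sum>i<n. \<Sum>j<n. w i * D $$ (i, j) * u i * u j) < 0"
begin

text \<open>The discrete Dirichlet energy, that is, the Hermitian form of -W D. It is written in
  real and imaginary parts so that it is real by construction.\<close>

definition energy :: "(nat \<Rightarrow> complex) \<Rightarrow> real" where
  "energy z = - (\<Sum>i<n. \<Sum>j<n. w i * D $$ (i, j) * Re (z i) * Re (z j))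
              - (\<Sum>i<n. \<Sum>j<n. w i * D $$ (i, j) * Im (z i) * Im (z j))"

lemma energy_eq:
  "of_real (energy z) = - (\<Sum>i<n. \<Sum>j<n. of_real (w i * D $$ (i, j)) * cnj (z i) * z j)"
  using hermitian_form_of_real[of n "\<lambda>i j. w i * D $$ (i, j)" z] sym by (simp add: energy_def)

lemma form_nonpos: "(\<Sum>i<n. \<Sum>j<n. w i * D $$ (i, j) * u i * u j) \<le> 0" for u :: "nat \<Rightarrow> real"
proof (cases "\<exists>i<n. u i \<noteq> 0")
  case True
  then show ?thesis using neg by (auto intro: less_imp_le)
next
  case False
  then have "(\<Sum>i<n. \<Sum>j<n. w i * D $$ (i, j) * u i * u j) = 0"
    by (intro sum.neutral ballI) auto
  then show ?thesis by simp
qed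

lemma energy_nonneg: "0 \<le> energy z"
  using form_nonpos[of "\<lambda>i. Re (z i)"] form_nonpos[of "\<lambda>i. Im (z i)"] by (simp add: energy_def)

lemma energy_pos:
  assumes "i < n" "z i \<noteq> 0"
  shows "0 < energy z"
proof -
  have "Re (z i) \<noteq> 0 \<or> Im (z i) \<noteq> 0"
    using assms(2) by (simp add: complex_eq_iff)
  then show ?thesis
    using neg[OF assms(1), of "\<lambda>i. Re (z i)"] neg[OF assms(1), of "\<lambda>i. Im (z i)"]
      form_nonpos[of "\<lambda>i. Re (z i)"] form_nonpos[of "\<lambda>i. Im (z i)"]
    by (auto simp: energy_def)
qed

lemma energy_le:
  assumes "\<And>k. eigenvalue D k \<Longrightarrow> - m \<le> k"
  shows "energy z \<le> m * (\<Sum>i<n. w i * (cmod (z i))\<^sup>2)"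
  using rayleigh_lower[of D n w "- m" "\<lambda>i. Re (z i)"] rayleigh_lower[of D n w "- m" "\<lambda>i. Im (z i)"]
    D w sym assms
  by (simp add: energy_def cmod_power2 distrib_left sum.distrib)

lemma energy_ge:
  assumes "\<And>k. eigenvalue D k \<Longrightarrow> k \<le> - m"
  shows "m * (\<Sum>i<n. w i * (cmod (z i))\<^sup>2) \<le> energy z"
  using rayleigh_upper[of D n w "- m" "\<lambda>i. Re (z i)"] rayleigh_upper[of D n w "- m" "\<lambda>i. Im (z i)"]
    D w sym assms
  by (simp add: energy_def cmod_power2 distrib_left sum.distrib)

end

locale separable_operator = weighted_symmetric_negative +
  fixes a b :: "nat \<Rightarrow> real"
  assumes a: "i < n \<Longrightarrow> 0 < a i" and b: "i < n \<Longrightarrow> 0 < b i"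
begin

text \<open>The action of \<open>K_L\<close>, sign included, freed from flattened indices:
  \<open>p\<close> is the outer Kronecker index and belongs to y, \<open>q\<close> the inner one and
  belongs to x.\<close>

definition laplacian :: "(nat \<Rightarrow> nat \<Rightarrow> complex) \<Rightarrow> nat \<Rightarrow> nat \<Rightarrow> complex" where
  "laplacian z p q = - of_real (a q) * (\<Sum>s<n. of_real (D $$ (q, s)) * z p s)
                     - of_real (b p) * (\<Sum>r<n. of_real (D $$ (p, r)) * z r q)"

text \<open>The diagonal of M. In the x-term, 1 / \<open>a q\<close> cancels the coefficient,
  \<open>w q\<close> symmetrises \<open>D\<close> in \<open>q\<close>, and \<open>w p / b p\<close>
  remains, which does not depend on \<open>q\<close>; the y-term is the mirror image.\<close>

definition weight :: "nat \<Rightarrow> nat \<Rightarrow> real" where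
  "weight p q = w p * w q / (b p * a q)"

definition total_energy :: "(nat \<Rightarrow> nat \<Rightarrow> complex) \<Rightarrow> real" where
  "total_energy z = (\<Sum>p<n. w p / b p * energy (z p)) + (\<Sum>q<n. w q / a q * energy (\<lambda>p. z p q))"

definition mass :: "(nat \<Rightarrow> nat \<Rightarrow> complex) \<Rightarrow> real" where
  "mass z = (\<Sum>p<n. \<Sum>q<n. weight p q * (cmod (z p q))\<^sup>2)"

lemma weight_pos: "\<lbrakk>p < n; q < n\<rbrakk> \<Longrightarrow> 0 < weight p q"
  using w a b by (simp add: weight_def)

lemma mass_pos:
  assumes "p < n" "q < n" "z p q \<noteq> 0"
  shows "0 < mass z"
proof -
  have "0 \<le> weight p q * (cmod (z p q))\<^sup>2" if "p < n" "q < n" for p q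
    using weight_pos[OF that] by simp
  moreover have "0 < weight p q * (cmod (z p q))\<^sup>2"
    using weight_pos assms by simp
  ultimately show ?thesis
    unfolding mass_def using assms
    by (intro sum_pos2[of _ p] sum_pos2[of _ q] sum_nonneg) auto
qed

lemma total_energy_pos:
  assumes "p < n" "q < n" "z p q \<noteq> 0"
  shows "0 < total_energy z"
proof -
  have "0 < w p / b p * energy (z p)"
    using w b energy_pos[of q "z p"] assms by simp
  then have "0 < (\<Sum>p<n. w p / b p * energy (z p))"
    using assms w b energy_nonneg by (intro sum_pos2[of _ p]) (auto simp: less_imp_le)
  moreover have "0 \<le> (\<Sum>q<n. w q / a q * energy (\<lambda>p. z p q))"
    using w a energy_nonneg by (intro sum_nonneg) (auto simp: less_imp_le)
  ultimately show ?thesis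
    by (simp add: total_energy_def)
qed

lemma laplacian_form:
  "(\<Sum>p<n. \<Sum>q<n. of_real (weight p q) * cnj (z p q) * laplacian z p q) = of_real (total_energy z)"
proof -
  have "(\<Sum>p<n. \<Sum>q<n. of_real (weight p q) * cnj (z p q) * laplacian z p q) =
    (\<Sum>p<n. \<Sum>q<n.
      of_real (w p / b p) * - (\<Sum>s<n. of_real (w q * D $$ (q, s)) * cnj (z p q) * z p s) +
      of_real (w q / a q) * - (\<Sum>r<n. of_real (w p * D $$ (p, r)) * cnj (z p q) * z r q))"
  proof (intro sum.cong refl)
    fix p q assume "p \<in> {..<n}" "q \<in> {..<n}"
    then have "a q \<noteq> 0" "b p \<noteq> 0"
      using a[of q] b[of p] by auto
    then have e: "of_real (weight p q) * cnj (z p q) * laplacian z p q =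
        - (of_real (w p / b p) * (of_real (w q) * cnj (z p q) * (\<Sum>s<n. of_real (D $$ (q, s)) * z p s)))
        - of_real (w q / a q) * (of_real (w p) * cnj (z p q) * (\<Sum>r<n. of_real (D $$ (p, r)) * z r q))"
      by (simp add: weight_def laplacian_def field_simps)
    show "of_real (weight p q) * cnj (z p q) * laplacian z p q =
      of_real (w p / b p) * - (\<Sum>s<n. of_real (w q * D $$ (q, s)) * cnj (z p q) * z p s) +
      of_real (w q / a q) * - (\<Sum>r<n. of_real (w p * D $$ (p, r)) * cnj (z p q) * z r q)"
      unfolding e sum_distrib_left[of "of_real (w q) * cnj (z p q)"]
        sum_distrib_left[of "of_real (w p) * cnj (z p q)"] by (simp add: mult_ac)
  qed
  \<comment> \<open>Only the second double sum has to be exchanged, so that its inner sums run along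
    the columns of the grid.\<close>
  also have "\<dots> = (\<Sum>p<n. of_real (w p / b p) * of_real (energy (z p))) +
      (\<Sum>q<n. of_real (w q / a q) * of_real (energy (\<lambda>p. z p q)))"
    unfolding sum.distrib energy_eq sum_negf[symmetric] sum_distrib_left
    by (rule arg_cong2[where f = "(+)"], rule refl, rule sum.swap)
  also have "\<dots> = of_real (total_energy z)"
    by (simp add: total_energy_def)
  finally show ?thesis .
qed

text \<open>\<open>C\<close> plays the role of the diagonal matrix $\mathbf C_d \otimes \mathbf C_c$.\<close>

lemma generalized_eigenvalue:
  assumes eq: "\<And>p q. \<lbrakk>p < n; q < n\<rbrakk> \<Longrightarrow> \<nu> * laplacian z p q = of_real (C p q) * z p q"
    and nz: "p < n" "q < n" "z p q \<noteq> 0"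
  shows "\<nu> = of_real ((\<Sum>p<n. \<Sum>q<n. weight p q * (cmod (z p q))\<^sup>2 * C p q) / total_energy z)"
proof -
  have "\<nu> * of_real (total_energy z) =
      (\<Sum>p<n. \<Sum>q<n. of_real (weight p q) * cnj (z p q) * (\<nu> * laplacian z p q))"
    unfolding laplacian_form[symmetric] sum_distrib_left by (simp only: mult_ac)
  also have "\<dots> = (\<Sum>p<n. \<Sum>q<n. of_real (weight p q * (cmod (z p q))\<^sup>2 * C p q))"
    by (intro sum.cong refl) (simp add: eq complex_norm_square mult_ac del: of_real_power)
  finally show ?thesis
    using total_energy_pos[of p q z, OF nz] by (simp add: field_simps)
qed

text \<open>In the row energies \<open>w p / b p * w q\<close> equals
  \<open>a q * weight p q\<close>, so the bound on \<open>a\<close> controls the rows; likewise the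
  bound on \<open>b\<close> controls the columns. Each direction contributes
  \<open>m * \<beta> * mass z\<close>.\<close>

lemma total_energy_le:
  assumes ev: "\<And>k. eigenvalue D k \<Longrightarrow> - m \<le> k" and "0 \<le> m"
    and bnd: "\<And>i. i < n \<Longrightarrow> a i \<le> \<beta>" "\<And>i. i < n \<Longrightarrow> b i \<le> \<beta>"
  shows "total_energy z \<le> 2 * m * \<beta> * mass z"
proof -
  have 1: "w p / b p * energy (z p) \<le> m * \<beta> * (\<Sum>q<n. weight p q * (cmod (z p q))\<^sup>2)" if p: "p < n" for p
  proof -
    have "w p / b p * energy (z p) \<le> w p / b p * (m * (\<Sum>q<n. w q * (cmod (z p q))\<^sup>2))"
      using energy_le[OF ev] w[OF p] b[OF p] by (intro mult_left_mono) auto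
    also have "\<dots> = m * (\<Sum>q<n. a q * (weight p q * (cmod (z p q))\<^sup>2))"
      unfolding sum_distrib_left using a b p by (intro sum.cong refl) (force simp: weight_def)
    also have "\<dots> \<le> m * (\<Sum>q<n. \<beta> * (weight p q * (cmod (z p q))\<^sup>2))"
      using bnd weight_pos[OF p] \<open>0 \<le> m\<close>
      by (intro mult_left_mono sum_mono mult_right_mono) (auto simp: less_imp_le)
    finally show ?thesis by (simp add: sum_distrib_left mult.assoc)
  qed
  have 2: "w q / a q * energy (\<lambda>p. z p q) \<le> m * \<beta> * (\<Sum>p<n. weight p q * (cmod (z p q))\<^sup>2)" if q: "q < n" for q
  proof -
    have "w q / a q * energy (\<lambda>p. z p q) \<le> w q / a q * (m * (\<Sum>p<n. w p * (cmod (z p q))\<^sup>2))"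
      using energy_le[OF ev] w[OF q] a[OF q] by (intro mult_left_mono) auto
    also have "\<dots> = m * (\<Sum>p<n. b p * (weight p q * (cmod (z p q))\<^sup>2))"
      unfolding sum_distrib_left using a b q by (intro sum.cong refl) (force simp: weight_def)
    also have "\<dots> \<le> m * (\<Sum>p<n. \<beta> * (weight p q * (cmod (z p q))\<^sup>2))"
      using bnd weight_pos[OF _ q] \<open>0 \<le> m\<close>
      by (intro mult_left_mono sum_mono mult_right_mono) (auto simp: less_imp_le)
    finally show ?thesis by (simp add: sum_distrib_left mult.assoc)
  qed
  have "total_energy z \<le> (\<Sum>p<n. m * \<beta> * (\<Sum>q<n. weight p q * (cmod (z p q))\<^sup>2)) +
      (\<Sum>q<n. m * \<beta> * (\<Sum>p<n. weight p q * (cmod (z p q))\<^sup>2))"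
    unfolding total_energy_def using 1 2 by (intro add_mono sum_mono) auto
  also have "\<dots> = m * \<beta> * mass z + m * \<beta> * mass z"
    unfolding mass_def sum_distrib_left[symmetric] by (subst (2) sum.swap) simp
  finally show ?thesis by (simp add: mult_ac)
qed

lemma total_energy_ge:
  assumes ev: "\<And>k. eigenvalue D k \<Longrightarrow> k \<le> - m" and "0 \<le> m"
    and bnd: "\<And>i. i < n \<Longrightarrow> \<alpha> \<le> a i" "\<And>i. i < n \<Longrightarrow> \<alpha> \<le> b i"
  shows "2 * m * \<alpha> * mass z \<le> total_energy z"
proof -
  have 1: "m * \<alpha> * (\<Sum>q<n. weight p q * (cmod (z p q))\<^sup>2) \<le> w p / b p * energy (z p)" if p: "p < n" for p
  proof -
    have "m * \<alpha> * (\<Sum>q<n. weight p q * (cmod (z p q))\<^sup>2) = m * (\<Sum>q<n. \<alpha> * (weight p q * (cmod (z p q))\<^sup>2))"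
      by (simp add: sum_distrib_left mult.assoc)
    also have "\<dots> \<le> m * (\<Sum>q<n. a q * (weight p q * (cmod (z p q))\<^sup>2))"
      using bnd weight_pos[OF p] \<open>0 \<le> m\<close>
      by (intro mult_left_mono sum_mono mult_right_mono) (auto simp: less_imp_le)
    also have "\<dots> = w p / b p * (m * (\<Sum>q<n. w q * (cmod (z p q))\<^sup>2))"
      unfolding sum_distrib_left using a b p by (intro sum.cong refl) (force simp: weight_def)
    also have "\<dots> \<le> w p / b p * energy (z p)"
      using energy_ge[OF ev] w[OF p] b[OF p] by (intro mult_left_mono) auto
    finally show ?thesis .
  qed
  have 2: "m * \<alpha> * (\<Sum>p<n. weight p q * (cmod (z p q))\<^sup>2) \<le> w q / a q * energy (\<lambda>p. z p q)" if q: "q < n" for q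
  proof -
    have "m * \<alpha> * (\<Sum>p<n. weight p q * (cmod (z p q))\<^sup>2) = m * (\<Sum>p<n. \<alpha> * (weight p q * (cmod (z p q))\<^sup>2))"
      by (simp add: sum_distrib_left mult.assoc)
    also have "\<dots> \<le> m * (\<Sum>p<n. b p * (weight p q * (cmod (z p q))\<^sup>2))"
      using bnd weight_pos[OF _ q] \<open>0 \<le> m\<close>
      by (intro mult_left_mono sum_mono mult_right_mono) (auto simp: less_imp_le)
    also have "\<dots> = w q / a q * (m * (\<Sum>p<n. w p * (cmod (z p q))\<^sup>2))"
      unfolding sum_distrib_left using a b q by (intro sum.cong refl) (force simp: weight_def)
    also have "\<dots> \<le> w q / a q * energy (\<lambda>p. z p q)"
      using energy_ge[OF ev] w[OF q] a[OF q] by (intro mult_left_mono) auto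
    finally show ?thesis .
  qed
  have "m * \<alpha> * mass z + m * \<alpha> * mass z = (\<Sum>p<n. m * \<alpha> * (\<Sum>q<n. weight p q * (cmod (z p q))\<^sup>2)) +
      (\<Sum>q<n. m * \<alpha> * (\<Sum>p<n. weight p q * (cmod (z p q))\<^sup>2))"
    unfolding mass_def sum_distrib_left[symmetric] by (subst (2) sum.swap) simp
  also have "\<dots> \<le> total_energy z"
    unfolding total_energy_def using 1 2 by (intro add_mono sum_mono) auto
  finally show ?thesis by (simp add: mult_ac)
qed

end

section \<open>Kronecker products and the collocation matrices\<close>

lemma sum_lessThan_mult_div_mod:
  fixes f :: "nat \<Rightarrow> nat \<Rightarrow> 'a :: comm_monoid_add"
  shows "(\<Sum>k<n * m. f (k div m) (k mod m)) = (\<Sum>i<n. \<Sum>j<m. f i j)"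
proof -
  have "(\<Sum>k\<in>{i * m..<i * m + m}. f (k div m) (k mod m)) = (\<Sum>j<m. f i j)" for i
    using sum.shift_bounds_nat_ivl[of "\<lambda>k. f (k div m) (k mod m)" 0 "i * m" m]
    by (simp add: atLeast0LessThan add.commute)
  then show ?thesis
    by (simp add: sum.nat_group[symmetric])
qed

context
  fixes n :: nat
begin

lemma kronecker_carrier:
  "\<lbrakk>A \<in> carrier_mat n n; B \<in> carrier_mat n n\<rbrakk> \<Longrightarrow> kronecker A B \<in> carrier_mat (n * n) (n * n)"
  by (auto simp: kronecker_def)

lemma div_mod_less: "i < n * n \<Longrightarrow> i div n < n" "i < n * n \<Longrightarrow> i mod n < n"
  by (auto simp: less_mult_imp_div_less) (cases n; simp)

lemma index_less_square:
  assumes "p < n" "q < n"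
  shows "p * n + q < n * n"
proof -
  have "p * n + q < Suc p * n" using assms by simp
  also have "\<dots> \<le> n * n" using assms by (intro mult_le_mono1) simp
  finally show ?thesis .
qed

lemma index_kronecker:
  "\<lbrakk>A \<in> carrier_mat n n; B \<in> carrier_mat n n; i < n * n; j < n * n\<rbrakk> \<Longrightarrow>
    kronecker A B $$ (i, j) = A $$ (i div n, j div n) * B $$ (i mod n, j mod n)"
  by (auto simp: kronecker_def)

text \<open>The mixed-product rule: splitting the summation index into \<open>k div n\<close> and
  \<open>k mod n\<close> turns the sum into a product of two sums.\<close>

lemma kronecker_mult:
  fixes A B C D :: "'a :: comm_semiring_0 mat"
  assumes "A \<in> carrier_mat n n" "B \<in> carrier_mat n n" "C \<in> carrier_mat n n" "D \<in> carrier_mat n n"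
  shows "kronecker A B * kronecker C D = kronecker (A * C) (B * D)"
proof (rule eq_matI)
  note car = kronecker_carrier[OF assms(1,2)] kronecker_carrier[OF assms(3,4)]
    mult_carrier_mat[OF assms(1,3)] mult_carrier_mat[OF assms(2,4)]
  fix i j assume "i < dim_row (kronecker (A * C) (B * D))" "j < dim_col (kronecker (A * C) (B * D))"
  then have ij: "i < n * n" "j < n * n"
    using kronecker_carrier[OF car(3,4)] by auto
  have "(kronecker A B * kronecker C D) $$ (i, j) =
      (\<Sum>k<n * n. A $$ (i div n, k div n) * B $$ (i mod n, k mod n) *
        (C $$ (k div n, j div n) * D $$ (k mod n, j mod n)))"
    using ij assms by (simp add: index_mult_mat_sum[OF car(1,2)] index_kronecker)
  also have "\<dots> = (\<Sum>k<n. \<Sum>l<n. A $$ (i div n, k) * B $$ (i mod n, l) * (C $$ (k, j div n) * D $$ (l, j mod n)))"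
    by (rule sum_lessThan_mult_div_mod)
  also have "\<dots> = (\<Sum>k<n. A $$ (i div n, k) * C $$ (k, j div n)) * (\<Sum>l<n. B $$ (i mod n, l) * D $$ (l, j mod n))"
    unfolding sum_product by (intro sum.cong refl) (simp add: mult_ac)
  also have "\<dots> = kronecker (A * C) (B * D) $$ (i, j)"
    using ij div_mod_less by (simp add: index_kronecker[OF car(3,4)] index_mult_mat_sum[OF assms(1,3)]
      index_mult_mat_sum[OF assms(2,4)])
  finally show "(kronecker A B * kronecker C D) $$ (i, j) = kronecker (A * C) (B * D) $$ (i, j)" .
qed (use assms in \<open>auto simp: kronecker_def\<close>)

lemma kronecker_one: "kronecker (1\<^sub>m n) (1\<^sub>m n) = (1\<^sub>m (n * n) :: 'a :: semiring_1 mat)"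
proof (rule eq_matI)
  fix i j assume "i < dim_row (1\<^sub>m (n * n) :: 'a mat)" "j < dim_col (1\<^sub>m (n * n) :: 'a mat)"
  then have ij: "i < n * n" "j < n * n" by auto
  moreover have "i = j \<longleftrightarrow> i div n = j div n \<and> i mod n = j mod n"
    by (metis div_mult_mod_eq)
  ultimately show "kronecker (1\<^sub>m n) (1\<^sub>m n) $$ (i, j) = (1\<^sub>m (n * n) :: 'a mat) $$ (i, j)"
    using div_mod_less by (auto simp: index_kronecker)
qed (auto simp: kronecker_def)

end

text \<open>Substituting u = P v for an eigenvector v gives K u = v, so the eigenvalue equation
  reads K u + Q u = ev K u. The inverse is gone, and u is nonzero because K u is.\<close>

lemma eigenvalue_right_preconditioned:
  fixes K P Q :: "real mat" and ev :: complex
  assumes K: "K \<in> carrier_mat m m" and P: "P \<in> carrier_mat m m" and Q: "Q \<in> carrier_mat m m"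
    and KP: "K * P = 1\<^sub>m m" and ev: "eigenvalue (map_mat of_real ((K + Q) * P)) ev"
  obtains u where "u \<in> carrier_vec m" "u \<noteq> 0\<^sub>v m"
    "map_mat of_real Q *\<^sub>v u = (ev - 1) \<cdot>\<^sub>v (map_mat of_real K *\<^sub>v u)"
proof -
  let ?c = "map_mat (of_real :: real \<Rightarrow> complex)"
  obtain v where v: "v \<in> carrier_vec m" "v \<noteq> 0\<^sub>v m" "?c ((K + Q) * P) *\<^sub>v v = ev \<cdot>\<^sub>v v"
    using ev P K Q by (auto simp: eigenvalue_def eigenvector_def)
  have cK: "?c K \<in> carrier_mat m m" and cP: "?c P \<in> carrier_mat m m" and cQ: "?c Q \<in> carrier_mat m m"
    using K P Q by auto
  define u where "u = ?c P *\<^sub>v v"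
  have u: "u \<in> carrier_vec m"
    using cP v(1) by (simp add: u_def)
  have "?c K * ?c P = 1\<^sub>m m"
    by (simp add: of_real_hom.mat_hom_mult[OF K P, symmetric] KP of_real_hom.mat_hom_one)
  then have Ku: "?c K *\<^sub>v u = v"
    unfolding u_def using assoc_mult_mat_vec[OF cK cP v(1)] v(1) by simp
  have "?c (K + Q) = ?c K + ?c Q"
    using K Q by (intro eq_matI) auto
  then have "?c ((K + Q) * P) *\<^sub>v v = (?c K + ?c Q) *\<^sub>v u"
    unfolding u_def using K Q P cK cQ cP v(1)
    by (simp add: of_real_hom.mat_hom_mult[of _ m m _ m] assoc_mult_mat_vec[of _ m m _ m])
  then have "?c K *\<^sub>v u + ?c Q *\<^sub>v u = ev \<cdot>\<^sub>v v"
    using v(3) add_mult_distrib_mat_vec[OF cK cQ u] by simp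
  then have eq: "v + ?c Q *\<^sub>v u = ev \<cdot>\<^sub>v v"
    unfolding Ku .
  have "?c Q *\<^sub>v u = (ev - 1) \<cdot>\<^sub>v v"
  proof (rule eq_vecI)
    fix i assume "i < dim_vec ((ev - 1) \<cdot>\<^sub>v v)"
    then have "i < m" using v(1) by simp
    then have "v $ i + (?c Q *\<^sub>v u) $ i = ev * v $ i"
      using arg_cong[OF eq, of "\<lambda>x. x $ i"] v(1) cQ by simp
    then show "(?c Q *\<^sub>v u) $ i = ((ev - 1) \<cdot>\<^sub>v v) $ i"
      using \<open>i < m\<close> v(1) by (simp add: algebra_simps)
  qed (use v cQ in auto)
  moreover have "u \<noteq> 0\<^sub>v m"
  proof
    assume "u = 0\<^sub>v m"
    then have "?c K *\<^sub>v u = 0\<^sub>v m"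
      using cK by (intro eq_vecI) (auto simp: scalar_prod_def)
    then show False using Ku v(2) by simp
  qed
  ultimately show thesis
    using that[OF u] Ku by simp
qed

section \<open>The differentiation and Birkhoff matrices\<close>

lemma D2_carrier: "D2 N \<in> carrier_mat (N - 1) (N - 1)"
  by (simp add: D2_def)

lemma Cmat_carrier: "Cmat N f \<in> carrier_mat (N - 1) (N - 1)"
  by (simp add: Cmat_def)

lemma index_Cmat: "\<lbrakk>i < N - 1; j < N - 1\<rbrakk> \<Longrightarrow> Cmat N f $$ (i, j) = (if i = j then f (lgl N (Suc i)) else 0)"
  by (simp add: Cmat_def mat_diag_def)

lemma det_D2:
  assumes N: "N \<ge> 2"
  shows "det (D2 N) \<noteq> 0"
proof
  assume "det (D2 N) = 0"
  then obtain v where v: "v \<in> carrier_vec (N - 1)" "v \<noteq> 0\<^sub>v (N - 1)" "D2 N *\<^sub>v v = 0\<^sub>v (N - 1)"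
    using det_0_iff_vec_prod_zero[OF D2_carrier] by auto
  obtain i where i: "i < N - 1" "v $ i \<noteq> 0"
    using v(1,2) by (metis carrier_vecD dim_vec eq_vecI index_zero_vec(1) zero_carrier_vec)
  obtain w :: "nat \<Rightarrow> real" where
    neg: "\<And>u i. \<lbrakk>i < N - 1; u i \<noteq> 0\<rbrakk> \<Longrightarrow> (\<Sum>i<N-1. \<Sum>j<N-1. w i * D2 N $$ (i, j) * u i * u j) < 0"
    by (rule D2_weighted_symmetric_negative[OF N]) (rule that)
  have "(\<Sum>i<N-1. \<Sum>j<N-1. w i * D2 N $$ (i, j) * v $ i * v $ j) =
      (\<Sum>i<N-1. w i * v $ i * (D2 N *\<^sub>v v) $ i)"
    using v(1) by (intro sum.cong refl)
      (simp add: index_mult_mat_vec_sum[OF D2_carrier] sum_distrib_left mult_ac)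
  also have "\<dots> = 0"
    unfolding v(3) by simp
  finally show False
    using neg[of i "\<lambda>i. v $ i"] i by simp
qed

lemma interpolant_cong: "(\<And>i. i < N - 1 \<Longrightarrow> u i = v i) \<Longrightarrow> interpolant N u = interpolant N v"
  by (simp add: interpolant_def)

text \<open>Column \<open>j\<close> of the inverse consists of the nodal values of the Birkhoff
  polynomial: applying \<open>D2\<close> to that column gives the unit vector, which is the
  prescribed second derivative. Any other candidate is the interpolant of its own nodal values, and
  invertibility of \<open>D2\<close> fixes these.\<close>

lemma Bmat_eq_inverse:
  assumes N: "N \<ge> 2"
  shows "Bmat N = the (mat_inverse (D2 N))"
proof -
  define K where "K = the (mat_inverse (D2 N))"
  have K: "K \<in> carrier_mat (N - 1) (N - 1)" "D2 N * K = 1\<^sub>m (N - 1)" "K * D2 N = 1\<^sub>m (N - 1)"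
    unfolding K_def by (rule mat_inverse_nonsingular[OF D2_carrier det_D2[OF N]])+
  have birk: "birkhoff N (Suc j) = interpolant N (\<lambda>i. K $$ (i, j))" (is "_ = ?p") if j: "j < N - 1" for j
    unfolding birkhoff_def
  proof (rule the_equality)
    have "poly (pderiv (pderiv ?p)) (lgl N (Suc i)) = of_bool (i = j)" if "i < N - 1" for i
      unfolding interpolant_props(5)[OF N that] index_mult_mat_sum[OF D2_carrier K(1) that j, symmetric] K(2)
      using that j by simp
    then have "poly (pderiv (pderiv ?p)) (lgl N i) = of_bool (i = Suc j)" if "i \<in> {1..N-1}" for i
      using that by (cases i) auto
    then show "Polynomial.degree ?p \<le> N \<and> poly ?p (-1) = 0 \<and> poly ?p 1 = 0 \<and>
        (\<forall>i\<in>{1..N-1}. poly (pderiv (pderiv ?p)) (lgl N i) = of_bool (i = Suc j))"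
      using interpolant_props[OF N] by blast
    fix p :: "real poly"
    assume p: "Polynomial.degree p \<le> N \<and> poly p (-1) = 0 \<and> poly p 1 = 0 \<and>
        (\<forall>i\<in>{1..N-1}. poly (pderiv (pderiv p)) (lgl N i) = of_bool (i = Suc j))"
    define u where "u = (\<lambda>i. poly p (lgl N (Suc i)))"
    have pu: "p = interpolant N u"
      unfolding u_def using p by (intro interpolant_eqI[OF N]) auto
    have "D2 N *\<^sub>v vec (N - 1) u = unit_vec (N - 1) j"
    proof (rule eq_vecI)
      fix i assume "i < dim_vec (unit_vec (N - 1) j :: real vec)"
      then have i: "i < N - 1" by simp
      have "(D2 N *\<^sub>v vec (N - 1) u) $ i = poly (pderiv (pderiv p)) (lgl N (Suc i))"
        unfolding pu interpolant_props(5)[OF N i] using i by (simp add: index_mult_mat_vec_sum[OF D2_carrier])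
      also have "\<dots> = of_bool (i = j)"
        using p i by auto
      finally show "(D2 N *\<^sub>v vec (N - 1) u) $ i = unit_vec (N - 1) j $ i"
        using i j by simp
    qed (simp add: D2_def)
    then have "(K * D2 N) *\<^sub>v vec (N - 1) u = K *\<^sub>v unit_vec (N - 1) j"
      using assoc_mult_mat_vec[OF K(1) D2_carrier, of "vec (N - 1) u"] by simp
    then have "vec (N - 1) u = col K j"
      using K j by (auto intro!: eq_vecI)
    then have "u i = K $$ (i, j)" if "i < N - 1" for i
      using that K(1) j by (metis carrier_matD index_col index_vec)
    then show "p = ?p"
      unfolding pu by (rule interpolant_cong)
  qed
  show ?thesis
    unfolding K_def[symmetric]
    by (rule eq_matI) (use K(1) birk interpolant_props(4)[OF N] in \<open>auto simp: Bmat_def\<close>)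
qed

lemma Bmat_props:
  assumes N: "N \<ge> 2"
  shows "Bmat N \<in> carrier_mat (N - 1) (N - 1)"
    and "D2 N * Bmat N = 1\<^sub>m (N - 1)" and "Bmat N * D2 N = 1\<^sub>m (N - 1)"
  unfolding Bmat_eq_inverse[OF N] by (rule mat_inverse_nonsingular[OF D2_carrier det_D2[OF N]])+

lemma K_L_carrier: "K_L N a b \<in> carrier_mat ((N - 1) * (N - 1)) ((N - 1) * (N - 1))"
  unfolding K_L_def
  by (intro minus_carrier_mat kronecker_carrier mult_carrier_mat[OF Cmat_carrier D2_carrier] one_carrier_mat)

lemma K_B_eq:
  assumes N: "N \<ge> 2"
  shows "K_B N a b = K_L N a b * kronecker (Bmat N) (Bmat N)"
proof -
  note B = Bmat_props[OF N]
  note CD = mult_carrier_mat[OF Cmat_carrier D2_carrier]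
  have CDB: "Cmat N f * D2 N * Bmat N = Cmat N f" for f
    using assoc_mult_mat[OF Cmat_carrier D2_carrier B(1), of f] Cmat_carrier[of N f] B(2) by simp
  have X: "kronecker (1\<^sub>m (N - 1)) (Cmat N a * D2 N) \<in> carrier_mat ((N - 1) * (N - 1)) ((N - 1) * (N - 1))"
    and Y: "kronecker (Cmat N b * D2 N) (1\<^sub>m (N - 1)) \<in> carrier_mat ((N - 1) * (N - 1)) ((N - 1) * (N - 1))"
    and Z: "kronecker (Bmat N) (Bmat N) \<in> carrier_mat ((N - 1) * (N - 1)) ((N - 1) * (N - 1))"
    by (intro kronecker_carrier one_carrier_mat CD B(1))+
  have "K_L N a b * kronecker (Bmat N) (Bmat N) =
      - (kronecker (1\<^sub>m (N - 1)) (Cmat N a * D2 N) * kronecker (Bmat N) (Bmat N)) -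
      kronecker (Cmat N b * D2 N) (1\<^sub>m (N - 1)) * kronecker (Bmat N) (Bmat N)"
    unfolding K_L_def using X Y Z by (simp add: minus_mult_distrib_mat)
  also have "\<dots> = - kronecker (Bmat N) (Cmat N a) - kronecker (Cmat N b) (Bmat N)"
    unfolding kronecker_mult[OF one_carrier_mat CD B(1) B(1)] kronecker_mult[OF CD one_carrier_mat B(1) B(1)] CDB
    using B(1) by simp
  finally show ?thesis
    by (simp add: K_B_def)
qed

lemma A_B_eq:
  assumes N: "N \<ge> 2"
  shows "A_B N a b c d = A_L N a b c d * kronecker (Bmat N) (Bmat N)"
proof -
  note B = Bmat_props(1)[OF N]
  show ?thesis
    unfolding A_B_def A_L_def K_B_eq[OF N]
      add_mult_distrib_mat[OF K_L_carrier kronecker_carrier[OF Cmat_carrier Cmat_carrier] kronecker_carrier[OF B B]]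
      kronecker_mult[OF Cmat_carrier Cmat_carrier B B] ..
qed

lemma det_kronecker_Bmat:
  assumes N: "N \<ge> 2"
  shows "det (kronecker (Bmat N) (Bmat N)) \<noteq> 0"
proof
  note B = Bmat_props[OF N]
  assume "det (kronecker (Bmat N) (Bmat N)) = 0"
  then have "det (kronecker (D2 N) (D2 N) * kronecker (Bmat N) (Bmat N)) = 0"
    by (subst det_mult[OF kronecker_carrier[OF D2_carrier D2_carrier] kronecker_carrier[OF B(1) B(1)]]) simp
  then show False
    by (simp add: kronecker_mult[OF D2_carrier D2_carrier B(1) B(1)] B(2) kronecker_one)
qed

lemma preconditioned_eq:
  assumes N: "N \<ge> 2" and det: "det (K_L N a b) \<noteq> 0"
  shows "invertible_mat (K_B N a b)"
    and "A_L N a b c d * P_L N a b = A_B N a b c d * P_B N a b"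
proof -
  let ?BB = "kronecker (Bmat N) (Bmat N)"
  let ?m = "(N - 1) * (N - 1)"
  note K = K_L_carrier[of N a b]
  have BB: "?BB \<in> carrier_mat ?m ?m"
    by (intro kronecker_carrier Bmat_props(1)[OF N])
  have A: "A_L N a b c d \<in> carrier_mat ?m ?m"
    unfolding A_L_def by (intro add_carrier_mat kronecker_carrier Cmat_carrier)
  have KB: "K_B N a b \<in> carrier_mat ?m ?m"
    unfolding K_B_eq[OF N] using K BB by simp
  have detB: "det (K_B N a b) \<noteq> 0"
    unfolding K_B_eq[OF N] det_mult[OF K BB] using det det_kronecker_Bmat[OF N] by simp
  show "invertible_mat (K_B N a b)"
    using invertible_mat_nonsingular[OF KB detB] .
  have PL: "P_L N a b \<in> carrier_mat ?m ?m" "P_L N a b * K_L N a b = 1\<^sub>m ?m"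
    unfolding P_L_def by (rule mat_inverse_nonsingular[OF K det])+
  have PB: "P_B N a b \<in> carrier_mat ?m ?m" "K_B N a b * P_B N a b = 1\<^sub>m ?m"
    unfolding P_B_def by (rule mat_inverse_nonsingular[OF KB detB])+
  \<comment> \<open>So \<open>?BB * P_B N a b\<close> is a right inverse of \<open>K_L N a b\<close>
    and must coincide with \<open>P_L N a b\<close>; this is how the common factor cancels.\<close>
  have "K_L N a b * (?BB * P_B N a b) = 1\<^sub>m ?m"
    using PB(2) unfolding K_B_eq[OF N] assoc_mult_mat[OF K BB PB(1)] .
  then have "P_L N a b = P_L N a b * (K_L N a b * (?BB * P_B N a b))"
    using PL(1) by simp
  also have "\<dots> = ?BB * P_B N a b"
    unfolding assoc_mult_mat[OF PL(1) K mult_carrier_mat[OF BB PB(1)], symmetric] PL(2)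
    by (rule left_mult_one_mat[OF mult_carrier_mat[OF BB PB(1)]])
  finally show "A_L N a b c d * P_L N a b = A_B N a b c d * P_B N a b"
    unfolding A_B_eq[OF N] using assoc_mult_mat[OF A BB PB(1)] by simp
qed

section \<open>Collocation matrices acting on grid functions\<close>

lemma (in separable_operator) K_L_mult_vec:
  assumes n: "n = N - 1" and DN: "D = D2 N"
    and af: "\<And>i. a i = f (lgl N (Suc i))" and bf: "\<And>i. b i = g (lgl N (Suc i))"
    and u: "u \<in> carrier_vec (n * n)" and pq: "p < n" "q < n"
  shows "(map_mat of_real (K_L N f g) *\<^sub>v u) $ (p * n + q) = laplacian (\<lambda>p q. u $ (p * n + q)) p q"
proof -
  let ?c = "of_real :: real \<Rightarrow> complex"
  have car: "K_L N f g \<in> carrier_mat (n * n) (n * n)"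
    unfolding n by (rule K_L_carrier)
  note i = index_less_square[OF pq]
  have dm: "(p * n + q) div n = p" "(p * n + q) mod n = q"
    using pq by simp_all
  have CD: "(Cmat N h * D2 N) $$ (i, j) = h (lgl N (Suc i)) * D $$ (i, j)" if "i < n" "j < n" for h i j
    using that mat_diag_mult_left[OF D2_carrier, of N] by (simp add: Cmat_def n DN)
  have car': "1\<^sub>m n \<in> carrier_mat n n" "Cmat N h * D2 N \<in> carrier_mat n n" for h
    using mult_carrier_mat[OF Cmat_carrier D2_carrier] by (simp_all add: n)
  have entry: "K_L N f g $$ (p * n + q, j) =
      - (if p = j div n then a q * D $$ (q, j mod n) else 0) - (if q = j mod n then b p * D $$ (p, j div n) else 0)"
    if j: "j < n * n" for j
  proof -
    have k1: "kronecker (1\<^sub>m n) (Cmat N f * D2 N) $$ (p * n + q, j) = (if p = j div n then a q * D $$ (q, j mod n) else 0)"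
      using index_kronecker[OF car' i j] div_mod_less[OF j] pq by (simp add: dm CD af)
    have k2: "kronecker (Cmat N g * D2 N) (1\<^sub>m n) $$ (p * n + q, j) = (if q = j mod n then b p * D $$ (p, j div n) else 0)"
      using index_kronecker[OF car'(2,1) i j] div_mod_less[OF j] pq by (simp add: dm CD bf)
    show ?thesis
      unfolding K_L_def n[symmetric] k1[symmetric] k2[symmetric]
      using carrier_matD[OF kronecker_carrier[OF car'(1) car'(2)[of f]]]
        carrier_matD[OF kronecker_carrier[OF car'(2)[of g] car'(1)]] i j by simp
  qed
  let ?z = "\<lambda>p q. u $ (p * n + q)"
  have "(map_mat of_real (K_L N f g) *\<^sub>v u) $ (p * n + q) =
      (\<Sum>j<n * n. (- (if p = j div n then ?c (a q * D $$ (q, j mod n)) else 0)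
         - (if q = j mod n then ?c (b p * D $$ (p, j div n)) else 0)) * ?z (j div n) (j mod n))"
    unfolding index_mult_mat_vec_sum[OF map_carrier_mat[THEN iffD2, OF car] u i]
    by (intro sum.cong refl) (use car i in \<open>simp add: entry\<close>)
  also have "\<dots> = (\<Sum>r<n. \<Sum>s<n. (- (if p = r then ?c (a q * D $$ (q, s)) else 0)
         - (if q = s then ?c (b p * D $$ (p, r)) else 0)) * ?z r s)"
    by (rule sum_lessThan_mult_div_mod)
  also have "\<dots> = - (\<Sum>r<n. if r = p then (\<Sum>s<n. ?c (a q * D $$ (q, s)) * ?z r s) else 0)
      - (\<Sum>r<n. \<Sum>s<n. if s = q then ?c (b p * D $$ (p, r)) * ?z r s else 0)"
    unfolding sum_negf[symmetric] sum_subtractf[symmetric]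
  proof (rule sum.cong[OF refl])
    fix r
    have "(\<Sum>s<n. (- (if p = r then ?c (a q * D $$ (q, s)) else 0)
         - (if q = s then ?c (b p * D $$ (p, r)) else 0)) * ?z r s) =
      (\<Sum>s<n. - (if r = p then ?c (a q * D $$ (q, s)) * ?z r s else 0)
         - (if s = q then ?c (b p * D $$ (p, r)) * ?z r s else 0))"
      by (intro sum.cong refl) (auto simp: algebra_simps)
    then show "(\<Sum>s<n. (- (if p = r then ?c (a q * D $$ (q, s)) else 0)
         - (if q = s then ?c (b p * D $$ (p, r)) else 0)) * ?z r s) =
      - (if r = p then (\<Sum>s<n. ?c (a q * D $$ (q, s)) * ?z r s) else 0)
      - (\<Sum>s<n. if s = q then ?c (b p * D $$ (p, r)) * ?z r s else 0)"
      by (cases "r = p") (simp_all add: sum_subtractf sum_negf)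
  qed
  also have "\<dots> = laplacian ?z p q"
    using pq by (simp add: laplacian_def sum_distrib_left sum_negf mult.assoc)
  finally show ?thesis .
qed

lemma kronecker_Cmat_mult_vec:
  assumes n: "n = N - 1" and u: "u \<in> carrier_vec (n * n)" and pq: "p < n" "q < n"
  shows "(map_mat of_real (kronecker (Cmat N d) (Cmat N c)) *\<^sub>v u) $ (p * n + q) =
    of_real (c (lgl N (Suc q)) * d (lgl N (Suc p))) * (u :: complex vec) $ (p * n + q)"
proof -
  have C: "Cmat N h \<in> carrier_mat n n" for h
    unfolding n by (rule Cmat_carrier)
  note i = index_less_square[OF pq]
  have dm: "(p * n + q) div n = p" "(p * n + q) mod n = q"
    using pq by simp_all
  have entry: "kronecker (Cmat N d) (Cmat N c) $$ (p * n + q, j) =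
      (if j = p * n + q then c (lgl N (Suc q)) * d (lgl N (Suc p)) else 0)" if j: "j < n * n" for j
  proof -
    have "j = p * n + q \<longleftrightarrow> p = j div n \<and> q = j mod n"
      using dm by (metis div_mult_mod_eq)
    then show ?thesis
      using index_kronecker[OF C C i j] div_mod_less[OF j] pq unfolding dm by (auto simp: index_Cmat n)
  qed
  have "(map_mat of_real (kronecker (Cmat N d) (Cmat N c)) *\<^sub>v u) $ (p * n + q) =
      (\<Sum>j<n * n. if j = p * n + q then of_real (c (lgl N (Suc q)) * d (lgl N (Suc p))) * u $ j else 0)"
    unfolding index_mult_mat_vec_sum[OF map_carrier_mat[THEN iffD2, OF kronecker_carrier[OF C C]] u i]
    by (intro sum.cong refl) (use kronecker_carrier[OF C C, of d c] i in \<open>simp add: entry\<close>)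
  then show ?thesis using i by simp
qed

lemma nonzero_vec_square:
  assumes "u \<in> carrier_vec (n * n)" "u \<noteq> 0\<^sub>v (n * n)"
  obtains p q where "p < n" "q < n" "u $ (p * n + q) \<noteq> 0"
proof -
  obtain i where i: "i < n * n" "u $ i \<noteq> 0"
    using assms by (metis carrier_vecD dim_vec eq_vecI index_zero_vec(1) zero_carrier_vec)
  then show thesis
    using that[of "i div n" "i mod n"] div_mod_less[OF i(1)] by simp
qed

text \<open>A kernel vector would be a nonzero grid function of zero total energy. The kernel is
  taken over the complex numbers because the energy is defined for complex grid functions.\<close>

lemma (in separable_operator) det_K_L:
  assumes n: "n = N - 1" and DN: "D = D2 N"
    and af: "\<And>i. a i = f (lgl N (Suc i))" and bf: "\<And>i. b i = g (lgl N (Suc i))"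
  shows "det (K_L N f g) \<noteq> 0"
proof
  let ?K = "map_mat of_real (K_L N f g) :: complex mat"
  have K: "?K \<in> carrier_mat (n * n) (n * n)"
    unfolding n using K_L_carrier by simp
  assume "det (K_L N f g) = 0"
  then have "det ?K = 0"
    by (simp add: of_real_hom.hom_det)
  then obtain u where u: "u \<in> carrier_vec (n * n)" "u \<noteq> 0\<^sub>v (n * n)" "?K *\<^sub>v u = 0\<^sub>v (n * n)"
    using det_0_iff_vec_prod_zero[OF K] by auto
  let ?z = "\<lambda>p q. u $ (p * n + q)"
  obtain p q where pq: "p < n" "q < n" "?z p q \<noteq> 0"
    using nonzero_vec_square[OF u(1,2)] by blast
  have "laplacian ?z p q = 0" if "p < n" "q < n" for p q
    using K_L_mult_vec[OF n DN af bf u(1) that] u(3) index_less_square[OF that] by simp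
  then have "of_real (total_energy ?z) = (0 :: complex)"
    unfolding laplacian_form[symmetric] by (intro sum.neutral ballI) auto
  then show False
    using total_energy_pos[of p q ?z] pq by simp
qed

section \<open>Spectrum and eigenvalue bounds\<close>

lemma finite_complex_spectrum:
  assumes "A \<in> carrier_mat n n"
  shows "finite (complex_spectrum A)"
  unfolding complex_spectrum_def using assms by (intro card_finite_spectrum(1)) auto

text \<open>The Rayleigh bounds ask about real eigenvalues, whereas \<open>c_const\<close> and the
  spectral gap speak of the complex spectrum. This inclusion lets \<open>Min\<close> and
  \<open>Max\<close> of the real parts bound the real eigenvalues.\<close>

lemma eigenvalue_in_complex_spectrum:
  assumes "A \<in> carrier_mat n n" "eigenvalue A k"
  shows "k \<in> Re ` complex_spectrum A"
proof -
  have "of_real k \<in> complex_spectrum A"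
    using of_real_hom.eigenvalue_hom[OF assms] by (simp add: complex_spectrum_def spectrum_def)
  then show ?thesis by force
qed

text \<open>Strictness is tied to \<open>0 < qmax\<close>: for \<open>qmax = 0\<close> the product
  of \<open>c\<close> and \<open>d\<close> vanishes on the square, so every eigenvalue is 1 and
  equals the bound. The recalled gap of the spectrum of \<open>D2 N\<close> is a premise of the
  upper bound; the lower one refers to \<lambda>_1 through \<open>c_const\<close>.\<close>

theorem theorem3p2:
  fixes N :: nat and a b c d :: "real \<Rightarrow> real"
  assumes "N \<ge> 2"
    and "continuous_on {-1..1} a" "continuous_on {-1..1} b"
        "continuous_on {-1..1} c" "continuous_on {-1..1} d"
    and "\<And>x. x \<in> {-1..1} \<Longrightarrow> a x > 0" "\<And>y. y \<in> {-1..1} \<Longrightarrow> b y > 0"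
    and "\<And>x y. x \<in> {-1..1} \<Longrightarrow> y \<in> {-1..1} \<Longrightarrow> c x * d y \<ge> 0"
  shows
    "invertible_mat (K_L N a b) \<and> invertible_mat (K_B N a b) \<and>
     complex_spectrum (A_L N a b c d * P_L N a b) = complex_spectrum (A_B N a b c d * P_B N a b) \<and>
     (\<forall>ev\<in>complex_spectrum (A_L N a b c d * P_L N a b). ev \<in> \<real> \<and> Re ev \<ge> 1) \<and>
     (\<forall>\<alpha> \<beta> qmin qmax :: real.
        0 < \<alpha> \<and> (\<forall>x\<in>{-1..1}. \<alpha> \<le> a x \<and> a x \<le> \<beta> \<and> \<alpha> \<le> b x \<and> b x \<le> \<beta>) \<and>
        0 \<le> qmin \<and> (\<forall>x\<in>{-1..1}. \<forall>y\<in>{-1..1}. qmin \<le> c x * d y \<and> c x * d y \<le> qmax)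
        \<longrightarrow>
        (\<forall>ev\<in>complex_spectrum (A_L N a b c d * P_L N a b).
           1 + 2 * pi\<^sup>2 * qmin / (\<beta> * c_const N * real N ^ 4) \<le> Re ev \<and>
           ((\<forall>\<mu>\<in>complex_spectrum (D2 N). Re \<mu> < - (pi\<^sup>2 / 4)) \<longrightarrow>
              Re ev \<le> 1 + 2 * qmax / (\<alpha> * pi\<^sup>2) \<and>
              (0 < qmax \<longrightarrow> Re ev < 1 + 2 * qmax / (\<alpha> * pi\<^sup>2)))))"
proof -
  note N = assms(1)
  define n where "n = N - 1"
  define x where "x = (\<lambda>i. lgl N (Suc i))"
  have x: "x i \<in> {-1..1}" if "i < n" for i
    using lgl_interior(2)[OF N, of i] that by (auto simp: x_def n_def)
  obtain w :: "nat \<Rightarrow> real" where w: "\<And>i. i < N - 1 \<Longrightarrow> 0 < w i"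
    and sym: "\<And>i j. \<lbrakk>i < N - 1; j < N - 1\<rbrakk> \<Longrightarrow> w i * D2 N $$ (i, j) = w j * D2 N $$ (j, i)"
    and neg: "\<And>u i. \<lbrakk>i < N - 1; u i \<noteq> 0\<rbrakk> \<Longrightarrow> (\<Sum>i<N-1. \<Sum>j<N-1. w i * D2 N $$ (i, j) * u i * u j) < 0"
    by (rule D2_weighted_symmetric_negative[OF N]) (rule that)
  interpret separable_operator n "D2 N" w "\<lambda>i. a (x i)" "\<lambda>i. b (x i)"
    using D2_carrier w sym neg assms(6,7) x by unfold_locales (simp_all add: n_def)
  have det: "det (K_L N a b) \<noteq> 0"
    using det_K_L[OF n_def refl, of a b] by (simp add: x_def)
  note eq = preconditioned_eq[OF N det]
  define C where "C = (\<lambda>p q. c (x q) * d (x p))"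
  \<comment> \<open>The form of the zero-order term under M, so \<open>ev - 1\<close> becomes the
    quotient of \<open>G\<close> by the total energy.\<close>
  define G where "G = (\<lambda>z. \<Sum>p<n. \<Sum>q<n. weight p q * (cmod (z p q))\<^sup>2 * C p q)"
  have ratio: "\<exists>z. 0 < total_energy z \<and> 0 < mass z \<and> ev = of_real (1 + G z / total_energy z)"
    if ev: "ev \<in> complex_spectrum (A_L N a b c d * P_L N a b)" for ev
  proof -
    have KP: "P_L N a b \<in> carrier_mat (n * n) (n * n)" "K_L N a b * P_L N a b = 1\<^sub>m (n * n)"
      unfolding P_L_def n_def by (rule mat_inverse_nonsingular[OF K_L_carrier det])+
    have K: "K_L N a b \<in> carrier_mat (n * n) (n * n)"
      and Q: "kronecker (Cmat N d) (Cmat N c) \<in> carrier_mat (n * n) (n * n)"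
      unfolding n_def by (intro K_L_carrier kronecker_carrier Cmat_carrier)+
    have "eigenvalue (map_mat of_real ((K_L N a b + kronecker (Cmat N d) (Cmat N c)) * P_L N a b)) ev"
      using ev by (simp add: complex_spectrum_def spectrum_def A_L_def)
    from eigenvalue_right_preconditioned[OF K KP(1) Q KP(2) this]
    obtain u where u: "u \<in> carrier_vec (n * n)" "u \<noteq> 0\<^sub>v (n * n)"
      "map_mat of_real (kronecker (Cmat N d) (Cmat N c)) *\<^sub>v u = (ev - 1) \<cdot>\<^sub>v (map_mat of_real (K_L N a b) *\<^sub>v u)"
      by blast
    let ?z = "\<lambda>p q. u $ (p * n + q)"
    obtain p q where pq: "p < n" "q < n" "?z p q \<noteq> 0"
      using nonzero_vec_square[OF u(1,2)] by blast
    have "(ev - 1) * laplacian ?z p q = of_real (C p q) * ?z p q" if "p < n" "q < n" for p q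
    proof -
      have "p * n + q < dim_row (map_mat of_real (K_L N a b) :: complex mat)"
        using K index_less_square[OF that] by simp
      then have "((ev - 1) \<cdot>\<^sub>v (map_mat of_real (K_L N a b) *\<^sub>v u)) $ (p * n + q) = (ev - 1) * laplacian ?z p q"
        using K_L_mult_vec[OF n_def refl, of a b u p q] u(1) that by (simp add: x_def)
      then show ?thesis
        using kronecker_Cmat_mult_vec[OF n_def u(1) that, of d c] u(3) by (simp add: C_def x_def)
    qed
    from generalized_eigenvalue[of "ev - 1" ?z C, OF this pq]
    have "ev = of_real (1 + G ?z / total_energy ?z)"
      by (simp add: G_def algebra_simps)
    then show ?thesis
      using total_energy_pos[of p q ?z] mass_pos[of p q ?z] pq by blast
  qed
  have G_bounds: "lo * mass z \<le> G z \<and> G z \<le> hi * mass z"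
    if "\<forall>x\<in>{-1..1}. \<forall>y\<in>{-1..1}. lo \<le> c x * d y \<and> c x * d y \<le> hi" for lo hi z
  proof -
    have "0 \<le> weight p q * (cmod (z p q))\<^sup>2" if "p < n" "q < n" for p q
      using weight_pos[OF that] by simp
    then show ?thesis
      unfolding G_def mass_def sum_distrib_left C_def using that x
      by (auto intro!: sum_mono simp: mult.commute[of lo] mult.commute[of hi] mult_left_mono)
  qed
  have G_nonneg: "0 \<le> G z" for z
  proof -
    have "0 \<le> weight p q * (cmod (z p q))\<^sup>2 * C p q" if "p < n" "q < n" for p q
      using weight_pos[OF that] assms(8)[OF x[OF that(2)] x[OF that(1)]] by (simp add: C_def)
    then show ?thesis
      unfolding G_def by (intro sum_nonneg) simp
  qed
  show ?thesis
  proof (intro conjI allI impI ballI)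
    show "invertible_mat (K_L N a b)"
      by (rule invertible_mat_nonsingular[OF K_L_carrier det])
    show "invertible_mat (K_B N a b)"
      by (rule eq(1))
    show "complex_spectrum (A_L N a b c d * P_L N a b) = complex_spectrum (A_B N a b c d * P_B N a b)"
      by (simp only: eq(2))
  next
    fix ev assume "ev \<in> complex_spectrum (A_L N a b c d * P_L N a b)"
    then obtain z where "0 < total_energy z" "ev = of_real (1 + G z / total_energy z)"
      using ratio by blast
    then show "ev \<in> \<real>" "Re ev \<ge> 1"
      using G_nonneg[of z] by simp_all
  next
    fix \<alpha> \<beta> qmin qmax :: real and ev
    assume hyp: "0 < \<alpha> \<and> (\<forall>x\<in>{-1..1}. \<alpha> \<le> a x \<and> a x \<le> \<beta> \<and> \<alpha> \<le> b x \<and> b x \<le> \<beta>) \<and>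
        0 \<le> qmin \<and> (\<forall>x\<in>{-1..1}. \<forall>y\<in>{-1..1}. qmin \<le> c x * d y \<and> c x * d y \<le> qmax)"
      and ev: "ev \<in> complex_spectrum (A_L N a b c d * P_L N a b)"
    have ab: "\<alpha> \<le> a (x i)" "a (x i) \<le> \<beta>" "\<alpha> \<le> b (x i)" "b (x i) \<le> \<beta>" if "i < n" for i
      using hyp x[OF that] by blast+
    have "0 < \<beta>"
      using hyp by (meson atLeastAtMost_iff less_le_trans zero_le_one neg_le_0_iff_le order_refl le_less_trans)
    obtain z where z: "0 < total_energy z" "0 < mass z" "ev = of_real (1 + G z / total_energy z)"
      using ratio[OF ev] by blast
    have G: "qmin * mass z \<le> G z" "G z \<le> qmax * mass z"
      using G_bounds[of qmin qmax z] hyp by auto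
    let ?S = "Re ` complex_spectrum (D2 N)"
    have fin: "finite ?S"
      using finite_complex_spectrum[OF D2_carrier] by simp
    {
      \<comment> \<open>By definition of \<open>c_const\<close> this is c_N N^4 / (4 pi^2), so 1 /
        (2 m \<beta>) is 2 pi^2 / (\<beta> c_N N^4).\<close>
      define m where "m = - Min ?S"
      have ge: "- m \<le> k" if "eigenvalue (D2 N) k" for k
        unfolding m_def using eigenvalue_in_complex_spectrum[OF D2_carrier that] fin by simp
      \<comment> \<open>Tested on the constant vector 1: its energy is positive and at most
        \<open>m\<close> times the sum of the weights. Index 0 exists since
        \<open>N \<ge> 2\<close>.\<close>
      have "0 < m"
      proof -
        have "0 < energy (\<lambda>i. 1)"
          using N by (intro energy_pos[of 0]) (auto simp: n_def)
        also have "\<dots> \<le> m * (\<Sum>i<n. w i * (cmod 1)\<^sup>2)"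
          by (rule energy_le[OF ge])
        finally have "0 < m * (\<Sum>i<n. w i)" by simp
        moreover have "0 \<le> (\<Sum>i<n. w i)"
          using w by (intro sum_nonneg) (auto simp: n_def less_imp_le)
        ultimately show ?thesis
          by (simp add: zero_less_mult_iff)
      qed
      have "total_energy z \<le> 2 * m * \<beta> * mass z"
        using ab \<open>0 < m\<close> by (intro total_energy_le[OF ge]) auto
      then have "qmin / (2 * m * \<beta>) * total_energy z \<le> qmin / (2 * m * \<beta>) * (2 * m * \<beta> * mass z)"
        using hyp \<open>0 < m\<close> \<open>0 < \<beta>\<close> by (intro mult_left_mono) auto
      also have "\<dots> = qmin * mass z"
        using \<open>0 < m\<close> \<open>0 < \<beta>\<close> by simp
      finally have "qmin / (2 * m * \<beta>) \<le> G z / total_energy z"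
        using G(1) z(1) by (simp add: pos_le_divide_eq)
      moreover have "2 * pi\<^sup>2 * qmin / (\<beta> * c_const N * real N ^ 4) = qmin / (2 * m * \<beta>)"
        using N \<open>0 < m\<close> \<open>0 < \<beta>\<close> by (simp add: c_const_def m_def field_simps)
      ultimately show "1 + 2 * pi\<^sup>2 * qmin / (\<beta> * c_const N * real N ^ 4) \<le> Re ev"
        by (simp add: z(3))
    }
    assume gap: "\<forall>\<mu>\<in>complex_spectrum (D2 N). Re \<mu> < - (pi\<^sup>2 / 4)"
    define m where "m = - Max ?S"
    have "?S \<noteq> {}"
      unfolding complex_spectrum_def using spectrum_non_empty[OF map_carrier_mat[THEN iffD2, OF D2_carrier]] N by simp
    \<comment> \<open>The maximum over a finite nonempty set is attained, so the strict gap carries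
      over to \<open>m\<close>. The strict upper bound comes from here.\<close>
    then have m: "pi\<^sup>2 / 4 < m"
      using Max_in[OF fin] gap unfolding m_def by auto
    have "0 < pi\<^sup>2" by simp
    then have "0 < m" using m by linarith
    have "k \<le> - m" if "eigenvalue (D2 N) k" for k
      unfolding m_def using eigenvalue_in_complex_spectrum[OF D2_carrier that] fin by simp
    then have "2 * m * \<alpha> * mass z \<le> total_energy z"
      using ab \<open>0 < m\<close> by (intro total_energy_ge) auto
    moreover have "0 < 2 * m * \<alpha> * mass z"
      using \<open>0 < m\<close> hyp z(2) by simp
    \<comment> \<open>Needed because replacing a denominator by a smaller positive one enlarges a
      fraction only if its numerator is nonnegative.\<close>
    moreover have "0 \<le> qmax"
      using G(2) G_nonneg[of z] z(2) by (meson le_less_trans linorder_not_le mult_neg_pos)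
    ultimately have "G z / total_energy z \<le> (qmax * mass z) / (2 * m * \<alpha> * mass z)"
      using G(2) z by (intro frac_le) auto
    also have "\<dots> = qmax / (2 * m * \<alpha>)"
      using z(2) by simp
    finally have up: "Re ev \<le> 1 + qmax / (2 * m * \<alpha>)"
      by (simp add: z(3))
    have e: "2 * qmax / (\<alpha> * pi\<^sup>2) = qmax / (2 * (pi\<^sup>2 / 4) * \<alpha>)"
      by (simp add: field_simps)
    have lt: "2 * (pi\<^sup>2 / 4) * \<alpha> < 2 * m * \<alpha>" "0 < 2 * (pi\<^sup>2 / 4) * \<alpha>"
      using m hyp by auto
    then have "qmax / (2 * m * \<alpha>) \<le> qmax / (2 * (pi\<^sup>2 / 4) * \<alpha>)"
      using \<open>0 \<le> qmax\<close> by (intro divide_left_mono mult_pos_pos) (use hyp \<open>0 < m\<close> in auto)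
    then show "Re ev \<le> 1 + 2 * qmax / (\<alpha> * pi\<^sup>2)"
      using up unfolding e by linarith
    assume "0 < qmax"
    then have "qmax / (2 * m * \<alpha>) < qmax / (2 * (pi\<^sup>2 / 4) * \<alpha>)"
      using lt by (intro divide_strict_left_mono mult_pos_pos) (use hyp \<open>0 < m\<close> in auto)
    then show "Re ev < 1 + 2 * qmax / (\<alpha> * pi\<^sup>2)"
      using up unfolding e by linarith
  qed
qed

end
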